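(* Let $F \subset \mathbb{R}^d$ be a non-empty compact set. Suppose that there is a constant $D \ge 1$ such that for each $x \in F$ and each $0<r\le \operatorname{diam}(F)$ there exists a mapping $g \colon F \to F \cap B(x,r)$ for which $$D^{-1}r|y-z| \le |g(y)-g(z)| \le Dr|y-z|$$ for all $y,z \in F$. If $s=\dim_{\mathrm{H}}(F)$, then $\mathcal{H}^s(F)>0$ if and only if $F$ is Ahlfors $s$-regular.
   Context: $B(x,r)$ denotes the closed ball in $\mathbb{R}^d$ with centre $x$ and radius $r$; $\mathcal{H}^s$ is the $s$-dimensional Hausdorff measure (defined with covers weighted by $\operatorname{diam}(U_i)^s$) and $\dim_{\mathrm{H}}$ the Hausdorff dimension. A set $A \subset \mathbb{R}^d$ is Ahlfors $s$-regular if there exist a Radon measure $\mu$ supported on $A$ and a constant $C \ge 1$ such that $C^{-1}r^s \le \mu(B(x,r)) \le Cr^s$ for all $x \in A$ and $0<r<\operatorname{diam}(A)$. *)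

theory Defs
  imports "HOL-Analysis.Analysis"
begin

(* The weight diam(U)^s of a covering set. Since 0 powr 0 = 0 in HOL, the conventions
   diam({})^s = 0 and diam(U)^0 = 1 for non-empty U (singletons included) are spelled out. *)
definition hausdorff_weight :: "real \<Rightarrow> 'a::metric_space set \<Rightarrow> ennreal" where
  "hausdorff_weight s U =
     (if U = {} then 0 else if s = 0 then 1 else ennreal (diameter U powr s))"

(* Boundedness is required because diameter is meaningful only for bounded sets.
   Finite covers are included by padding with empty sets. *)
definition hausdorff_premeasure :: "real \<Rightarrow> real \<Rightarrow> 'a::metric_space set \<Rightarrow> ennreal" where
  "hausdorff_premeasure s \<delta> A =
     (INF U\<in>{U :: nat \<Rightarrow> 'a set. A \<subseteq> (\<Union>i. U i) \<and>
                 (\<forall>i. bounded (U i) \<and> diameter (U i) \<le> \<delta>)}.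
        (\<Sum>i. hausdorff_weight s (U i)))"

definition hausdorff_measure :: "real \<Rightarrow> 'a::metric_space set \<Rightarrow> ennreal" where
  "hausdorff_measure s A = (SUP \<delta>\<in>{0<..}. hausdorff_premeasure s \<delta> A)"

definition hausdorff_dim :: "'a::metric_space set \<Rightarrow> ereal" where
  "hausdorff_dim A = Inf (ereal ` {t. 0 \<le> t \<and> hausdorff_measure t A = 0})"

definition radon_measure :: "'a::t2_space measure \<Rightarrow> bool" where
  "radon_measure \<mu> \<longleftrightarrow>
     sets \<mu> = sets borel \<and>
     (\<forall>K. compact K \<longrightarrow> emeasure \<mu> K < \<infinity>) \<and>
     (\<forall>B\<in>sets borel. emeasure \<mu> B = (INF U\<in>{U. open U \<and> B \<subseteq> U}. emeasure \<mu> U)) \<and>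
     (\<forall>U. open U \<longrightarrow> emeasure \<mu> U = (SUP K\<in>{K. compact K \<and> K \<subseteq> U}. emeasure \<mu> K))"

(* "Supported on A" is read as: the complement of A is null. The upper limit r < diam(A)
   is void for unbounded A, where diam(A) is infinite but HOL's diameter is unspecified. *)
definition ahlfors_regular :: "real \<Rightarrow> 'a::metric_space set \<Rightarrow> bool" where
  "ahlfors_regular s A \<longleftrightarrow>
     (\<exists>\<mu> C. radon_measure \<mu> \<and> (AE x in \<mu>. x \<in> A) \<and> 1 \<le> C \<and>
        (\<forall>x\<in>A. \<forall>r. 0 < r \<and> (bounded A \<longrightarrow> r < diameter A) \<longrightarrow>
           ennreal (inverse C * r powr s) \<le> emeasure \<mu> (cball x r) \<and>
           emeasure \<mu> (cball x r) \<le> ennreal (C * r powr s)))"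

end

theory Submission imports Defs begin

text \<open>
  If the scaled copies of \<open>F\<close> in \<open>N\<close> well separated balls of radius \<open>r\<close> satisfied
  \<open>N (r/D)\<^sup>s > 1\<close>, then iterating the embeddings would force \<open>dim F > s\<close>. Hence an \<open>r\<close>-separated set has
  at most \<open>C r\<close> to the power \<open>-s\<close> points, and the Hausdorff measure of \<open>F\<close> is finite. Its restriction
  \<open>\<mu>\<close> to \<open>F\<close> satisfies the lower regularity bound because each ball contains a scaled copy of \<open>F\<close>.
  For the upper bound, one ball of relative mass at least \<open>K\<close> is copied by the embeddings next to every
  point at every scale; a greedy selection yields finitely many disjoint copies whose radii
  satisfy \<open>c \<le> (\<Sum>t\<^sup>s)\<close> with \<open>c\<close> independent of the initial ball, so \<open>K\<close> is bounded
  by a multiple of \<open>\<mu>(F)/c\<close>. The converse is the mass distribution principle.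
\<close>

section \<open>Metric outer measures\<close>

text \<open>The delicate point is that \<open>c\<close> must not see the size of the dense ball. A
  copy placed near a point at scale \<open>\<rho>\<close> has radius \<open>D * r * \<rho>\<close>,
  so for tiny \<open>r\<close> one layer of copies at a single scale contributes only a multiple of
  \<open>r powr s\<close> to the sum. The selection therefore continues at ever finer scales in the
  part of \<open>F\<close> not yet reached. Each layer may gain little, but while the sum is below
  \<open>c\<close> the gain has a positive lower bound, so a nearly supremal family cannot stay
  below \<open>c\<close>. Each copy is made by a single embedding, so distortion does not
  accumulate: relative mass drops by at most \<open>D powr (2 * s)\<close>, one
  \<open>D powr s\<close> for the mass of the image and one for the radius of the ball around it. In
  the dimension estimate no limit set is built. Compactness reduces covers to finite ones, and the
  iteration becomes an induction on the number of covering sets. The dimension supplies null measure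
  only at exponents at or just above \<open>s\<close>; the strict inequality is carried there by
  continuity.\<close>

lemma ennreal_summable_tail_le:
  fixes r :: "nat \<Rightarrow> ennreal"
  assumes "(\<Sum>i. r i) < \<infinity>" "0 < e"
  shows "\<exists>n. (\<Sum>i. r (i + n)) \<le> ennreal e"
proof -
  define \<rho> where "\<rho> i = enn2real (r i)" for i
  have fin: "r i < \<infinity>" for i
    using assms(1) ennreal_suminf_lessD by metis
  then have r: "r i = ennreal (\<rho> i)" for i
    by (simp add: \<rho>_def)
  have nonneg: "0 \<le> \<rho> i" for i by (simp add: \<rho>_def)
  have sm: "summable \<rho>"
    using assms(1) by (intro summable_suminf_not_top nonneg) (simp add: r[symmetric])
  obtain N where N: "\<And>n. n \<ge> N \<Longrightarrow> norm (\<Sum>i. \<rho> (i + n)) < e"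
    using suminf_exist_split[OF assms(2) sm] by blast
  have "(\<Sum>i. r (i + N)) = ennreal (\<Sum>i. \<rho> (i + N))"
    unfolding r by (intro suminf_ennreal2 nonneg) (simp add: sm)
  also have "\<dots> \<le> ennreal e"
    using N[of N] by (intro ennreal_leI) auto
  finally show ?thesis by blast
qed

text \<open>
  \<open>A - C\<close> is exhausted by its parts \<open>S n\<close> at distance at least \<open>1 / (n + 1)\<close> from \<open>C\<close>. The shell
  \<open>S (n + 2) - S (n + 1)\<close> is at positive distance from \<open>S n\<close>, so the measures of the shells telescope.
\<close>

lemma closed_lambda_system_metric:
  fixes f :: "'a::metric_space set \<Rightarrow> ennreal"
  assumes empty: "f {} = 0"
    and mono: "\<And>A B. A \<subseteq> B \<Longrightarrow> f A \<le> f B"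
    and csub: "\<And>A :: nat \<Rightarrow> 'a set. f (\<Union>i. A i) \<le> (\<Sum>i. f (A i))"
    and sub: "\<And>A B. f (A \<union> B) \<le> f A + f B"
    and sep: "\<And>A B e. 0 < e \<Longrightarrow> (\<And>x y. x \<in> A \<Longrightarrow> y \<in> B \<Longrightarrow> e \<le> dist x y) \<Longrightarrow>
                f A + f B \<le> f (A \<union> B)"
    and C: "closed C"
  shows "f (A \<inter> C) + f (A - C) \<le> f A"
proof (cases "C = {} \<or> f A = \<infinity>")
  \<comment> \<open>Since \<open>infdist x {} = 0\<close>, an empty \<open>C\<close> would make
    every \<open>S n\<close> below empty; this case is immediate anyway.\<close>
  case True
  then show ?thesis using empty by auto
next
  case False
  then have C0: "C \<noteq> {}" and fin: "f A < \<infinity>" by (auto simp: less_top)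
  define S where "S n = {x \<in> A. 1 / real (Suc n) \<le> infdist x C}" for n
  define R where "R n = S (Suc n) - S n" for n
  have S_mono: "S n \<subseteq> S (Suc n)" for n
  proof -
    have "1 / real (Suc (Suc n)) \<le> 1 / real (Suc n)" by (simp add: frac_le)
    then show ?thesis unfolding S_def by auto
  qed
  have S_A: "S n \<subseteq> A" for n by (auto simp: S_def)
  have gap: "f (S n) + f (R (Suc n)) \<le> f (S (Suc (Suc n)))" for n
  proof -
    have "f (S n) + f (R (Suc n)) \<le> f (S n \<union> R (Suc n))"
    proof (rule sep)
      show "0 < 1 / real (Suc n) - 1 / real (Suc (Suc n))"
        by (simp add: frac_less2)
      fix x y assume "x \<in> S n" "y \<in> R (Suc n)"
      then have "1 / real (Suc n) \<le> infdist x C" "infdist y C < 1 / real (Suc (Suc n))"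
        by (auto simp: S_def R_def)
      moreover have "infdist x C \<le> infdist y C + dist x y"
        by (rule infdist_triangle)
      ultimately show "1 / real (Suc n) - 1 / real (Suc (Suc n)) \<le> dist x y"
        by linarith
    qed
    also have "\<dots> \<le> f (S (Suc (Suc n)))"
      using S_mono[of n] S_mono[of "Suc n"] by (intro mono) (auto simp: R_def)
    finally show ?thesis .
  qed
  \<comment> \<open>Adjacent shells may touch, so additivity links only shells of equal parity; the
    two parity classes telescope separately, hence the two terms on the right.\<close>
  have partial: "(\<Sum>k<N. f (R (Suc k))) \<le> f (S N) + f (S (Suc N))" for N
  proof (induction N)
    case (Suc N)
    have "(\<Sum>k<Suc N. f (R (Suc k))) \<le> f (S (Suc N)) + (f (S N) + f (R (Suc N)))"
      using add_right_mono[OF Suc, of "f (R (Suc N))"] by (simp add: ac_simps)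
    also have "\<dots> \<le> f (S (Suc N)) + f (S (Suc (Suc N)))"
      by (rule add_left_mono[OF gap])
    finally show ?case .
  qed simp
  have "(\<Sum>k. f (R (Suc k))) \<le> f A + f A"
  proof (rule suminf_le_const)
    show "(\<Sum>k<N. f (R (Suc k))) \<le> f A + f A" for N
      by (rule order_trans[OF partial]) (intro add_mono mono S_A)
  qed simp
  also have "\<dots> < \<infinity>" using fin by simp
  finally have sumfin: "(\<Sum>k. f (R (Suc k))) < \<infinity>" .
  \<comment> \<open>Closedness of \<open>C\<close> enters here: a point off \<open>C\<close> has
    positive distance from it and lies in some \<open>S m\<close>; the least such index locates its
    shell.\<close>
  have split: "A - C \<subseteq> S n \<union> (\<Union>k. R (k + n))" for n
  proof
    fix x assume x: "x \<in> A - C"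
    then have "infdist x C > 0"
      using C C0 by (metis DiffD2 in_closed_iff_infdist_zero infdist_nonneg less_eq_real_def)
    then obtain m where "1 / real (Suc m) < infdist x C"
      using reals_Archimedean by (auto simp: inverse_eq_divide)
    then have xm: "x \<in> S m" using x by (auto simp: S_def)
    define p where "p = (LEAST j. x \<in> S j)"
    have p: "x \<in> S p" unfolding p_def by (rule LeastI[of "\<lambda>j. x \<in> S j", OF xm])
    have below: "x \<notin> S j" if "j < p" for j
      using that not_less_Least unfolding p_def by blast
    show "x \<in> S n \<union> (\<Union>k. R (k + n))"
    proof (cases "p \<le> n")
      case True
      have "S p \<subseteq> S n" using True S_mono by (rule lift_Suc_mono_le[rotated]) 
      then show ?thesis using p by auto
    next
      case False
      then obtain j where "p = Suc (j + n)"
        by (metis add.commute less_iff_Suc_add not_le)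
      then have "x \<in> R (j + n)" using p below by (auto simp: R_def)
      then show ?thesis by blast
    qed
  qed
  show ?thesis
  proof (rule ennreal_le_epsilon)
    fix e :: real assume "0 < e"
    then obtain n where n: "(\<Sum>i. f (R (Suc (i + n)))) \<le> ennreal e"
      using ennreal_summable_tail_le[OF sumfin] by blast
    have "f (A - C) \<le> f (S (Suc n) \<union> (\<Union>k. R (k + Suc n)))"
      by (rule mono[OF split])
    also have "\<dots> \<le> f (S (Suc n)) + (\<Sum>k. f (R (k + Suc n)))"
      by (rule order_trans[OF sub add_left_mono[OF csub]])
    also have "\<dots> \<le> f (S (Suc n)) + ennreal e"
      using n by (intro add_left_mono) simp
    finally have "f (A \<inter> C) + f (A - C) \<le> (f (A \<inter> C) + f (S (Suc n))) + ennreal e"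
      by (metis add.assoc add_left_mono)
    also have "f (A \<inter> C) + f (S (Suc n)) \<le> f (A \<inter> C \<union> S (Suc n))"
    proof (rule sep)
      show "0 < 1 / real (Suc (Suc n))" by simp
      fix x y assume xy: "x \<in> A \<inter> C" "y \<in> S (Suc n)"
      then have "1 / real (Suc (Suc n)) \<le> infdist y C" by (auto simp: S_def)
      also have "\<dots> \<le> dist y x" using xy by (intro infdist_le) auto
      finally show "1 / real (Suc (Suc n)) \<le> dist x y" by (simp add: dist_commute)
    qed
    also have "\<dots> \<le> f A" using S_A by (intro mono) auto
    finally show "f (A \<inter> C) + f (A - C) \<le> f A + ennreal e"
      by (simp add: add_right_mono)
  qed
qed

text \<open>Caratheodory's criterion: the sets that split \<open>f\<close> additively form a
  sigma-algebra on which \<open>f\<close> is a measure. It contains the closed sets, hence the Borel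
  sets, and \<open>f\<close> is restricted to these.\<close>

lemma borel_measure_of_metric_outer:
  fixes f :: "'a::metric_space set \<Rightarrow> ennreal"
  assumes empty: "f {} = 0"
    and mono: "\<And>A B. A \<subseteq> B \<Longrightarrow> f A \<le> f B"
    and csub: "\<And>A :: nat \<Rightarrow> 'a set. f (\<Union>i. A i) \<le> (\<Sum>i. f (A i))"
    and sep: "\<And>A B e. 0 < e \<Longrightarrow> (\<And>x y. x \<in> A \<Longrightarrow> y \<in> B \<Longrightarrow> e \<le> dist x y) \<Longrightarrow>
                f A + f B \<le> f (A \<union> B)"
  obtains \<mu> where "sets \<mu> = sets borel" "\<And>A. A \<in> sets borel \<Longrightarrow> emeasure \<mu> A = f A"
proof -
  let ?L = "lambda_system UNIV (Pow UNIV) f"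
  interpret P: sigma_algebra UNIV "Pow UNIV :: 'a set set" by (rule sigma_algebra_Pow)
  have om: "outer_measure_space (Pow UNIV) f"
    unfolding outer_measure_space_def positive_def increasing_def countably_subadditive_def
    using empty mono csub by auto
  have sub: "f (A \<union> B) \<le> f A + f B" for A B
  proof -
    have "f (A \<union> B) = f (\<Union>i. binaryset A B i)" by (simp add: UN_binaryset_eq)
    also have "\<dots> \<le> (\<Sum>i. f (binaryset A B i))" by (rule csub)
    also have "\<dots> = f A + f B" using suminf_binaryset_eq empty by metis
    finally show ?thesis .
  qed
  have L: "measure_space UNIV ?L f" by (rule P.caratheodory_lemma[OF om])
  then interpret L: sigma_algebra UNIV ?L by (simp add: measure_space_def)
  have closed_L: "C \<in> ?L" if "closed C" for C
  proof -
    have "f (A \<inter> C) + f (A - C) = f A" for A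
      using closed_lambda_system_metric[OF empty mono csub sub sep that, where A = A]
        sub[of "A \<inter> C" "A - C"] by (simp add: Int_Diff_Un antisym)
    then show ?thesis unfolding P.lambda_system_eq by simp
  qed
  have "sigma_sets UNIV (Collect closed) \<subseteq> ?L"
    using closed_L by (intro L.sigma_sets_subset) blast
  then have borel_L: "sets (borel :: 'a measure) \<subseteq> ?L"
    unfolding borel_eq_closed by (simp add: sets_measure_of)
  have ms: "measure_space UNIV (sets (borel :: 'a measure)) f"
    unfolding measure_space_def
  proof (intro conjI)
    show "sigma_algebra UNIV (sets (borel :: 'a measure))"
      using sets.sigma_algebra_axioms[of "borel :: 'a measure"] by simp
    show "positive (sets (borel :: 'a measure)) f" by (simp add: positive_def empty)
    show "countably_additive (sets (borel :: 'a measure)) f"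
      using L borel_L unfolding measure_space_def countably_additive_def by blast
  qed
  show thesis
  proof
    let ?\<mu> = "measure_of UNIV (sets (borel :: 'a measure)) f"
    show "sets ?\<mu> = sets borel"
      using sets.sigma_sets_eq[of "borel :: 'a measure"] by simp
    show "emeasure ?\<mu> A = f A" if "A \<in> sets borel" for A
      using emeasure_measure_of_sigma[of UNIV "sets (borel :: 'a measure)" f A] ms that
      unfolding measure_space_def by simp
  qed
qed

section \<open>Hausdorff measure\<close>

lemma diameter_le_dist:
  fixes S :: "'a::metric_space set"
  assumes "0 \<le> c" "\<And>x y. x \<in> S \<Longrightarrow> y \<in> S \<Longrightarrow> dist x y \<le> c"
  shows "diameter S \<le> c"
  using assms by (auto simp: diameter_def intro!: cSUP_least)

lemma hausdorff_weight_empty [simp]: "hausdorff_weight s {} = 0"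
  by (simp add: hausdorff_weight_def)

lemma hausdorff_weight_pos:
  assumes "s \<noteq> 0" shows "hausdorff_weight s U = ennreal (diameter U powr s)"
  using assms by (simp add: hausdorff_weight_def)

lemma hausdorff_premeasure_empty [simp]:
  assumes "0 \<le> \<delta>" shows "hausdorff_premeasure s \<delta> {} = 0"
proof -
  have "hausdorff_premeasure s \<delta> {} \<le> (\<Sum>i::nat. hausdorff_weight s {})"
    unfolding hausdorff_premeasure_def using assms
    by (intro INF_lower2[of "\<lambda>_. {}"]) auto
  then show ?thesis by simp
qed

lemma hausdorff_premeasure_mono:
  "A \<subseteq> B \<Longrightarrow> hausdorff_premeasure s \<delta> A \<le> hausdorff_premeasure s \<delta> B"
  unfolding hausdorff_premeasure_def by (rule INF_superset_mono) auto

lemma hausdorff_premeasure_antimono: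
  "\<delta> \<le> \<delta>' \<Longrightarrow> hausdorff_premeasure s \<delta>' A \<le> hausdorff_premeasure s \<delta> A"
  unfolding hausdorff_premeasure_def by (rule INF_superset_mono) (auto intro: order_trans)

lemma hausdorff_premeasure_le:
  assumes "A \<subseteq> (\<Union>i. U i)" "\<And>i. bounded (U i)" "\<And>i. diameter (U i) \<le> \<delta>"
  shows "hausdorff_premeasure s \<delta> A \<le> (\<Sum>i. hausdorff_weight s (U i))"
  unfolding hausdorff_premeasure_def using assms by (intro INF_lower) auto

lemma hausdorff_premeasure_cover:
  assumes "hausdorff_premeasure s \<delta> A < c"
  obtains U where "A \<subseteq> (\<Union>i. U i)" "\<And>i. bounded (U i)" "\<And>i. diameter (U i) \<le> \<delta>"
    "(\<Sum>i. hausdorff_weight s (U i)) < c"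
  using assms unfolding hausdorff_premeasure_def INF_less_iff by auto

lemma hausdorff_premeasure_countable_subadditive:
  "hausdorff_premeasure s \<delta> (\<Union>i. A i) \<le> (\<Sum>i. hausdorff_premeasure s \<delta> (A i))"
proof (rule ennreal_le_epsilon)
  fix e :: real assume e: "0 < e"
    and fin: "(\<Sum>i. hausdorff_premeasure s \<delta> (A i)) < top"
  have "\<exists>U. A i \<subseteq> (\<Union>j. U j) \<and> (\<forall>j. bounded (U j) \<and> diameter (U j) \<le> \<delta>) \<and>
      (\<Sum>j. hausdorff_weight s (U j)) \<le> hausdorff_premeasure s \<delta> (A i) + ennreal (e * (1/2) ^ Suc i)"
    for i
  proof -
    have "hausdorff_premeasure s \<delta> (A i) < top"
      using fin ennreal_suminf_lessD by blast
    then have "hausdorff_premeasure s \<delta> (A i) <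
        hausdorff_premeasure s \<delta> (A i) + ennreal (e * (1/2) ^ Suc i)"
      using e by (simp add: ennreal_add_left_cancel_less[where b = 0, simplified])
    then show ?thesis by (rule hausdorff_premeasure_cover) (meson less_imp_le)
  qed
  then obtain U where U: "\<And>i. A i \<subseteq> (\<Union>j. U i j)" "\<And>i j. bounded (U i j)"
      "\<And>i j. diameter (U i j) \<le> \<delta>"
      "\<And>i. (\<Sum>j. hausdorff_weight s (U i j)) \<le>
        hausdorff_premeasure s \<delta> (A i) + ennreal (e * (1/2) ^ Suc i)"
    by metis
  define V where "V k = (case prod_decode k of (i, j) \<Rightarrow> U i j)" for k
  have "(\<Union>i. A i) \<subseteq> (\<Union>k. V k)"
  proof
    fix x assume "x \<in> (\<Union>i. A i)"
    then obtain i j where "x \<in> U i j" using U(1) by blast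
    then have "x \<in> V (prod_encode (i, j))" by (simp add: V_def)
    then show "x \<in> (\<Union>k. V k)" by blast
  qed
  then have "hausdorff_premeasure s \<delta> (\<Union>i. A i) \<le> (\<Sum>k. hausdorff_weight s (V k))"
    by (rule hausdorff_premeasure_le) (auto simp: V_def U split: prod.split)
  also have "\<dots> = (\<Sum>k. (\<lambda>(i, j). hausdorff_weight s (U i j)) (prod_decode k))"
    by (simp add: V_def split: prod.split) (simp add: case_prod_unfold)
  also have "\<dots> = (\<Sum>i. \<Sum>j. hausdorff_weight s (U i j))"
    by (rule suminf_ennreal_2dimen) simp
  also have "\<dots> \<le> (\<Sum>i. hausdorff_premeasure s \<delta> (A i) + ennreal (e * (1/2) ^ Suc i))"
    by (intro suminf_le U) simp_all
  also have "\<dots> = (\<Sum>i. hausdorff_premeasure s \<delta> (A i)) + (\<Sum>i. ennreal (e * (1/2) ^ Suc i))"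
    by (intro suminf_add[symmetric]) simp_all
  also have "(\<Sum>i. ennreal (e * (1/2) ^ Suc i)) = ennreal e"
  proof (rule sums_unique[symmetric])
    have "(\<lambda>i. e * (1/2) ^ Suc i) sums (e * 1)"
      by (intro sums_mult power_half_series)
    then show "(\<lambda>i. ennreal (e * (1/2) ^ Suc i)) sums ennreal e"
      using e by (subst sums_ennreal) auto
  qed
  finally show "hausdorff_premeasure s \<delta> (\<Union>i. A i) \<le>
      (\<Sum>i. hausdorff_premeasure s \<delta> (A i)) + ennreal e" .
qed

lemma hausdorff_premeasure_Un:
  assumes "0 \<le> \<delta>"
  shows "hausdorff_premeasure s \<delta> (A \<union> B) \<le> hausdorff_premeasure s \<delta> A + hausdorff_premeasure s \<delta> B"
proof -
  have "hausdorff_premeasure s \<delta> (A \<union> B) \<le> (\<Sum>i. hausdorff_premeasure s \<delta> (binaryset A B i))"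
    using hausdorff_premeasure_countable_subadditive[of s \<delta> "binaryset A B"]
    by (simp add: UN_binaryset_eq)
  also have "\<dots> = hausdorff_premeasure s \<delta> A + hausdorff_premeasure s \<delta> B"
    by (rule suminf_binaryset_eq) (simp add: assms)
  finally show ?thesis .
qed

text \<open>A set of diameter at most \<open>\<delta> < e\<close> cannot meet both \<open>A\<close>
  and \<open>B\<close>, so every admissible cover of the union splits into covers of the two parts
  that share no set.\<close>

lemma hausdorff_premeasure_separated:
  assumes \<delta>: "0 \<le> \<delta>" "\<delta> < e" and dist: "\<And>x y. x \<in> A \<Longrightarrow> y \<in> B \<Longrightarrow> e \<le> dist x y"
  shows "hausdorff_premeasure s \<delta> A + hausdorff_premeasure s \<delta> B \<le> hausdorff_premeasure s \<delta> (A \<union> B)"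
proof -
  have "hausdorff_premeasure s \<delta> A + hausdorff_premeasure s \<delta> B \<le> (\<Sum>i. hausdorff_weight s (U i))"
    if U: "A \<union> B \<subseteq> (\<Union>i. U i)" "\<forall>i. bounded (U i) \<and> diameter (U i) \<le> \<delta>" for U :: "nat \<Rightarrow> 'a set"
  proof -
    define V where "V X i = (if U i \<inter> X = {} then {} else U i)" for X i
    have V: "hausdorff_premeasure s \<delta> X \<le> (\<Sum>i. hausdorff_weight s (V X i))"
      if "X \<subseteq> A \<union> B" for X
    proof (rule hausdorff_premeasure_le)
      show "X \<subseteq> (\<Union>i. V X i)"
      proof
        fix x assume x: "x \<in> X"
        then obtain i where "x \<in> U i" using U(1) \<open>X \<subseteq> A \<union> B\<close> by blast
        then have "x \<in> V X i" using x by (auto simp: V_def)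
        then show "x \<in> (\<Union>i. V X i)" by blast
      qed
      show "bounded (V X i)" "diameter (V X i) \<le> \<delta>" for i
        using U(2) \<delta> by (auto simp: V_def)
    qed
    have VAB: "V A i = {} \<or> V B i = {}" for i
    proof (rule ccontr)
      assume "\<not> ?thesis"
      then obtain x y where "x \<in> U i \<inter> A" "y \<in> U i \<inter> B" by (auto simp: V_def split: if_splits)
      then have "e \<le> dist x y" "dist x y \<le> diameter (U i)"
        using dist diameter_bounded_bound[of "U i" x y] U(2) by auto
      then show False using U(2) \<delta> by (meson not_le order_trans order.strict_trans2)
    qed
    have "hausdorff_weight s (V A i) + hausdorff_weight s (V B i) \<le> hausdorff_weight s (U i)" for i
    proof (cases "V A i = {}")
      case True
      then show ?thesis by (simp add: V_def)
    next
      case False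
      then have "V B i = {}" using VAB by blast
      then show ?thesis by (simp add: V_def)
    qed
    then have "(\<Sum>i. hausdorff_weight s (V A i)) + (\<Sum>i. hausdorff_weight s (V B i)) \<le>
        (\<Sum>i. hausdorff_weight s (U i))"
      by (subst suminf_add) (auto intro!: suminf_le)
    then show ?thesis
      using add_mono[OF V[of A] V[of B]] by (simp add: order_trans)
  qed
  then show ?thesis
    unfolding hausdorff_premeasure_def[of s \<delta> "A \<union> B"] by (intro INF_greatest) auto
qed

lemma hausdorff_premeasure_le_measure:
  "0 < \<delta> \<Longrightarrow> hausdorff_premeasure s \<delta> A \<le> hausdorff_measure s A"
  unfolding hausdorff_measure_def by (rule SUP_upper) simp

lemma hausdorff_measure_empty [simp]: "hausdorff_measure s {} = 0"
proof -
  have "hausdorff_measure s {} \<le> (0 :: ennreal)"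
    unfolding hausdorff_measure_def by (rule SUP_least) simp
  then show ?thesis by simp
qed

lemma hausdorff_measure_mono:
  "A \<subseteq> B \<Longrightarrow> hausdorff_measure s A \<le> hausdorff_measure s B"
  unfolding hausdorff_measure_def by (intro SUP_mono') (rule hausdorff_premeasure_mono)

lemma hausdorff_measure_countable_subadditive:
  "hausdorff_measure s (\<Union>i. A i) \<le> (\<Sum>i. hausdorff_measure s (A i))"
  unfolding hausdorff_measure_def[of s "\<Union>i. A i"]
proof (rule SUP_least)
  fix \<delta> :: real assume "\<delta> \<in> {0<..}"
  then have "(\<Sum>i. hausdorff_premeasure s \<delta> (A i)) \<le> (\<Sum>i. hausdorff_measure s (A i))"
    by (intro suminf_le hausdorff_premeasure_le_measure) simp_all
  then show "hausdorff_premeasure s \<delta> (\<Union>i. A i) \<le> (\<Sum>i. hausdorff_measure s (A i))"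
    by (rule order_trans[OF hausdorff_premeasure_countable_subadditive])
qed

lemma hausdorff_measure_separated:
  assumes "0 < e" "\<And>x y. x \<in> A \<Longrightarrow> y \<in> B \<Longrightarrow> e \<le> dist x y"
  shows "hausdorff_measure s A + hausdorff_measure s B \<le> hausdorff_measure s (A \<union> B)"
proof -
  have "hausdorff_measure s A + hausdorff_measure s B =
      (SUP \<delta>\<in>{0<..}. hausdorff_premeasure s \<delta> A + hausdorff_premeasure s \<delta> B)"
    unfolding hausdorff_measure_def
  proof (rule SUP_add_directed_ennreal[symmetric])
    fix i j :: real assume "i \<in> {0<..}" "j \<in> {0<..}"
    then show "\<exists>k\<in>{0<..}. hausdorff_premeasure s i A + hausdorff_premeasure s j B \<le>
        hausdorff_premeasure s k A + hausdorff_premeasure s k B"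
      by (intro bexI[of _ "min i j"] add_mono hausdorff_premeasure_antimono) auto
  qed
  also have "\<dots> \<le> hausdorff_measure s (A \<union> B)"
  proof (rule SUP_least)
    fix \<delta> :: real assume \<delta>: "\<delta> \<in> {0<..}"
    \<comment> \<open>Shrinking the scale only increases the premeasures, and below \<open>e\<close>
      they add up on \<open>A\<close> and \<open>B\<close>.\<close>
    let ?\<epsilon> = "min \<delta> (e / 2)"
    have "hausdorff_premeasure s \<delta> A + hausdorff_premeasure s \<delta> B \<le>
        hausdorff_premeasure s ?\<epsilon> A + hausdorff_premeasure s ?\<epsilon> B"
      by (intro add_mono hausdorff_premeasure_antimono) auto
    also have "\<dots> \<le> hausdorff_premeasure s ?\<epsilon> (A \<union> B)"
      using \<delta> assms by (intro hausdorff_premeasure_separated[of _ e]) auto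
    also have "\<dots> \<le> hausdorff_measure s (A \<union> B)"
      using \<delta> assms by (intro hausdorff_premeasure_le_measure) auto
    finally show "hausdorff_premeasure s \<delta> A + hausdorff_premeasure s \<delta> B \<le>
        hausdorff_measure s (A \<union> B)" .
  qed
  finally show ?thesis .
qed

text \<open>The trace of Hausdorff measure on \<open>F\<close> is the candidate for the regular
  measure. Intersecting with \<open>F\<close> keeps the metric outer measure property and makes the
  measure vanish off \<open>F\<close>.\<close>

lemma hausdorff_measure_restricted:
  fixes F :: "'a::metric_space set"
  obtains \<mu> where "sets \<mu> = sets borel"
    "\<And>A. A \<in> sets borel \<Longrightarrow> emeasure \<mu> A = hausdorff_measure s (A \<inter> F)"
proof (rule borel_measure_of_metric_outer[of "\<lambda>A. hausdorff_measure s (A \<inter> F)"])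
  show "hausdorff_measure s ((\<Union>i. A i) \<inter> F) \<le> (\<Sum>i. hausdorff_measure s (A i \<inter> F))"
    for A :: "nat \<Rightarrow> 'a set"
    using hausdorff_measure_countable_subadditive[of s "\<lambda>i. A i \<inter> F"] by (simp add: Int_commute)
  show "hausdorff_measure s (A \<inter> F) + hausdorff_measure s (B \<inter> F) \<le> hausdorff_measure s ((A \<union> B) \<inter> F)"
    if "0 < e" "\<And>x y. x \<in> A \<Longrightarrow> y \<in> B \<Longrightarrow> e \<le> dist x y" for A B e
    using hausdorff_measure_separated[of e "A \<inter> F" "B \<inter> F"] that by (simp add: Int_Un_distrib2)
qed (auto intro: hausdorff_measure_mono)

text \<open>Every cover has a non-empty member, which weighs 1 at exponent 0. This excludes 0 as an
  exponent of vanishing measure and settles one-point sets.\<close>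

lemma hausdorff_measure_0_pos:
  assumes "A \<noteq> {}" shows "1 \<le> hausdorff_measure 0 A"
proof -
  have "1 \<le> (\<Sum>i. hausdorff_weight 0 (U i))"
    if "A \<subseteq> (\<Union>i. U i)" for U :: "nat \<Rightarrow> 'a set"
  proof -
    obtain i where "U i \<noteq> {}" using assms \<open>A \<subseteq> (\<Union>i. U i)\<close> by blast
    then have "1 = hausdorff_weight 0 (U i)" by (simp add: hausdorff_weight_def)
    also have "\<dots> \<le> (\<Sum>i. hausdorff_weight 0 (U i))"
      using sum_le_suminf[of "\<lambda>i. hausdorff_weight 0 (U i)" "{i}"] by simp
    finally show ?thesis .
  qed
  then have "1 \<le> hausdorff_premeasure 0 1 A"
    unfolding hausdorff_premeasure_def by (intro INF_greatest) auto
  also have "\<dots> \<le> hausdorff_measure 0 A" by (simp add: hausdorff_premeasure_le_measure)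
  finally show ?thesis .
qed

text \<open>Preimages under \<open>g\<close> turn a cover of the image into a cover of
  \<open>A\<close> with diameters enlarged by at most the factor \<open>1 / q\<close>. Applied to
  self-embeddings, this gives every lower bound for the mass of a copy.\<close>

lemma hausdorff_measure_lower_lipschitz:
  assumes s: "0 < s" and q: "0 < q"
    and g: "\<And>y z. y \<in> A \<Longrightarrow> z \<in> A \<Longrightarrow> q * dist y z \<le> dist (g y) (g z)"
  shows "ennreal (q powr s) * hausdorff_measure s A \<le> hausdorff_measure s (g ` A)"
proof -
  have "ennreal (q powr s) * hausdorff_premeasure s \<delta> A \<le> hausdorff_measure s (g ` A)"
    if \<delta>: "0 < \<delta>" for \<delta>
  proof -
    have "ennreal (q powr s) * hausdorff_premeasure s \<delta> A \<le> (\<Sum>i. hausdorff_weight s (U i))"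
      if U: "g ` A \<subseteq> (\<Union>i. U i)" "\<forall>i. bounded (U i) \<and> diameter (U i) \<le> q * \<delta>" for U :: "nat \<Rightarrow> 'b set"
    proof -
      define V where "V i = {x \<in> A. g x \<in> U i}" for i
      have d: "dist x y \<le> diameter (U i) / q" if "x \<in> V i" "y \<in> V i" for x y i
      proof -
        have "q * dist x y \<le> dist (g x) (g y)" using that g by (auto simp: V_def)
        also have "\<dots> \<le> diameter (U i)"
          using that U by (intro diameter_bounded_bound) (auto simp: V_def)
        finally show ?thesis using q by (simp add: field_simps)
      qed
      have nn: "0 \<le> diameter (U i) / q" for i using U q by (simp add: diameter_ge_0)
      have diam: "diameter (V i) \<le> diameter (U i) / q" for i
        by (rule diameter_le_dist[OF nn d])
      have bV: "bounded (V i)" for i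
        unfolding bounded_two_points using d by blast
      have "hausdorff_premeasure s \<delta> A \<le> (\<Sum>i. hausdorff_weight s (V i))"
      proof (rule hausdorff_premeasure_le[OF _ bV])
        show "A \<subseteq> (\<Union>i. V i)" using U by (auto simp: V_def)
        show "diameter (V i) \<le> \<delta>" for i
        proof -
          have "diameter (U i) / q \<le> \<delta>" using U q by (simp add: field_simps)
          then show ?thesis using diam[of i] by simp
        qed
      qed
      then have "ennreal (q powr s) * hausdorff_premeasure s \<delta> A \<le>
          (\<Sum>i. ennreal (q powr s) * hausdorff_weight s (V i))"
        by (simp add: mult_left_mono)
      also have "\<dots> \<le> (\<Sum>i. hausdorff_weight s (U i))"
      proof (intro suminf_le)
        fix i
        have "q powr s * diameter (V i) powr s = (q * diameter (V i)) powr s"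
          using q diameter_ge_0[OF bV] by (simp add: powr_mult)
        also have "\<dots> \<le> diameter (U i) powr s"
          using diam[of i] q s diameter_ge_0[OF bV] by (intro powr_mono2) (auto simp: field_simps)
        finally show "ennreal (q powr s) * hausdorff_weight s (V i) \<le> hausdorff_weight s (U i)"
          using s by (simp add: hausdorff_weight_pos flip: ennreal_mult)
      qed simp_all
      finally show ?thesis .
    qed
    then have "ennreal (q powr s) * hausdorff_premeasure s \<delta> A \<le> hausdorff_premeasure s (q * \<delta>) (g ` A)"
      unfolding hausdorff_premeasure_def[of s "q * \<delta>"] by (intro INF_greatest) auto
    also have "\<dots> \<le> hausdorff_measure s (g ` A)"
      using q \<delta> by (intro hausdorff_premeasure_le_measure) simp
    finally show ?thesis .
  qed
  then have "(SUP \<delta>\<in>{0<..}. ennreal (q powr s) * hausdorff_premeasure s \<delta> A) \<le> hausdorff_measure s (g ` A)"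
    by (intro SUP_least) auto
  then show ?thesis
    unfolding hausdorff_measure_def[of s A] by (simp add: SUP_mult_left_ennreal)
qed

section \<open>Self-embeddings and dimension\<close>

text \<open>
  If no \<open>U i\<close> has diameter at least \<open>\<rho>\<close>, each meets at most one of the pieces \<open>g j ` F\<close>. The cheapest
  subcover of a piece costs at most a fraction \<open>1 / card J\<close> of the total and has fewer sets; pulled back
  by \<open>g j\<close> it covers \<open>F\<close> at no higher cost.
\<close>

lemma self_embedding_cover_bound:
  fixes F :: "'a::metric_space set" and g :: "'j \<Rightarrow> 'a \<Rightarrow> 'a"
  assumes "finite I" "F \<noteq> {}" "F \<subseteq> (\<Union>i\<in>I. U i)" "\<And>i. i \<in> I \<Longrightarrow> bounded (U i)"
    and J: "finite J" "2 \<le> card J"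
    and t: "0 < t" and q: "0 < q" "1 \<le> real (card J) * q powr t" and \<rho>: "0 < \<rho>"
    and g: "\<And>j. j \<in> J \<Longrightarrow> g j ` F \<subseteq> F"
    and lower: "\<And>j y z. j \<in> J \<Longrightarrow> y \<in> F \<Longrightarrow> z \<in> F \<Longrightarrow> q * dist y z \<le> dist (g j y) (g j z)"
    and sep: "\<And>j k y z. j \<in> J \<Longrightarrow> k \<in> J \<Longrightarrow> j \<noteq> k \<Longrightarrow> y \<in> F \<Longrightarrow> z \<in> F \<Longrightarrow> \<rho> \<le> dist (g j y) (g k z)"
  shows "\<rho> powr t \<le> (\<Sum>i\<in>I. diameter (U i) powr t)"
  using assms(1-4)
proof (induction "card I" arbitrary: I U rule: less_induct)
  case less
  note bU = less.prems(4)
  define w where "w V = diameter V powr t" for V :: "'a set"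
  have w0: "0 \<le> w V" for V by (simp add: w_def)
  show ?case
  proof (cases "\<exists>i\<in>I. \<rho> \<le> diameter (U i)")
    case True
    then obtain i where i: "i \<in> I" "\<rho> \<le> diameter (U i)" by blast
    have "\<rho> powr t \<le> w (U i)"
      unfolding w_def using i t \<rho> by (intro powr_mono2) auto
    also have "\<dots> \<le> (\<Sum>i\<in>I. w (U i))"
      using less.prems i w0 by (intro member_le_sum) auto
    finally show ?thesis by (simp add: w_def)
  next
    case False
    define K where "K j = {i \<in> I. U i \<inter> g j ` F \<noteq> {}}" for j
    have K_sub: "K j \<subseteq> I" for j by (auto simp: K_def)
    have K_fin: "finite (K j)" for j using K_sub less.prems(1) finite_subset by blast
    have K_disj: "K j \<inter> K k = {}" if "j \<in> J" "k \<in> J" "j \<noteq> k" for j k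
    proof (rule ccontr)
      assume "\<not> ?thesis"
      then obtain i y z where iyz: "i \<in> I" "y \<in> F" "g j y \<in> U i" "z \<in> F" "g k z \<in> U i"
        by (auto simp: K_def)
      then have "\<rho> \<le> dist (g j y) (g k z)" using sep that by blast
      also have "\<dots> \<le> diameter (U i)" using iyz bU by (intro diameter_bounded_bound) auto
      finally show False using False iyz by blast
    qed
    obtain x where x: "x \<in> F" using \<open>F \<noteq> {}\<close> by blast
    have K_ne: "K j \<noteq> {}" if "j \<in> J" for j
    proof -
      have "g j x \<in> F" using g that x by blast
      then obtain i where "i \<in> I" "g j x \<in> U i" using less.prems(3) by blast
      then show ?thesis using x by (auto simp: K_def)
    qed
    have "(\<Sum>j\<in>J. \<Sum>i\<in>K j. w (U i)) = (\<Sum>i\<in>(\<Union>j\<in>J. K j). w (U i))"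
      using J K_fin K_disj by (subst sum.UNION_disjoint) auto
    also have "\<dots> \<le> (\<Sum>i\<in>I. w (U i))"
      using less.prems(1) by (intro sum_mono2) (simp_all add: w0 UN_least K_sub)
    finally have total: "(\<Sum>j\<in>J. \<Sum>i\<in>K j. w (U i)) \<le> (\<Sum>i\<in>I. w (U i))" .
    have "\<exists>j\<in>J. real (card J) * (\<Sum>i\<in>K j. w (U i)) \<le> (\<Sum>i\<in>I. w (U i))"
    proof (rule ccontr)
      assume "\<not> ?thesis"
      then have gt: "(\<Sum>i\<in>I. w (U i)) / real (card J) < (\<Sum>i\<in>K j. w (U i))" if "j \<in> J" for j
        using that J by (auto simp: field_simps not_le)
      have "(\<Sum>j\<in>J. (\<Sum>i\<in>I. w (U i)) / real (card J)) < (\<Sum>j\<in>J. \<Sum>i\<in>K j. w (U i))"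
        using J gt by (intro sum_strict_mono) auto
      moreover have "J \<noteq> {}" using J by auto
      ultimately show False using total J by simp
    qed
    then obtain j where j: "j \<in> J" "real (card J) * (\<Sum>i\<in>K j. w (U i)) \<le> (\<Sum>i\<in>I. w (U i))" by blast
    \<comment> \<open>A second piece exists because \<open>2 \<le> card J\<close>. Its subcover is
      non-empty and disjoint from \<open>K j\<close>, so \<open>K j\<close> is a proper subset of
      \<open>I\<close> and the induction can proceed.\<close>
    obtain k where k: "k \<in> J" "k \<noteq> j"
    proof -
      have "card {j} < card J" using J by simp
      then have "\<not> J \<subseteq> {j}" by (meson card_mono finite.intros leD)
      then show thesis using that by blast
    qed
    have "K j \<subset> I"
      using K_ne[OF k(1)] K_disj[OF j(1) k(1)] k(2) K_sub[of j] K_sub[of k] by blast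
    then have smaller: "card (K j) < card I" using less.prems(1) by (rule psubset_card_mono[rotated])
    define V where "V i = {y \<in> F. g j y \<in> U i}" for i
    have d: "dist y z \<le> diameter (U i) / q" if "i \<in> I" "y \<in> V i" "z \<in> V i" for i y z
    proof -
      have "q * dist y z \<le> dist (g j y) (g j z)" using that lower j by (auto simp: V_def)
      also have "\<dots> \<le> diameter (U i)"
        using that bU by (intro diameter_bounded_bound) (auto simp: V_def)
      finally show ?thesis using q by (simp add: field_simps)
    qed
    have bV: "bounded (V i)" if "i \<in> I" for i
      unfolding bounded_two_points using d[OF that] by blast
    have "F \<subseteq> (\<Union>i\<in>K j. V i)"
    proof
      fix y assume y: "y \<in> F"
      then have "g j y \<in> F" using g j by blast
      then obtain i where "i \<in> I" "g j y \<in> U i" using less.prems(3) by blast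
      then show "y \<in> (\<Union>i\<in>K j. V i)" using y by (auto simp: K_def V_def)
    qed
    then have "\<rho> powr t \<le> (\<Sum>i\<in>K j. diameter (V i) powr t)"
      using K_sub bV by (intro less.hyps[OF smaller K_fin \<open>F \<noteq> {}\<close>]) auto
    also have "\<dots> \<le> (\<Sum>i\<in>K j. real (card J) * w (U i))"
    proof (rule sum_mono)
      fix i assume "i \<in> K j"
      then have i: "i \<in> I" using K_sub by blast
      have "diameter (V i) \<le> diameter (U i) / q"
        using d[OF i] q bU[OF i] by (intro diameter_le_dist) (auto simp: diameter_ge_0)
      then have "q * diameter (V i) \<le> diameter (U i)" using q by (simp add: field_simps)
      then have "(q * diameter (V i)) powr t \<le> w (U i)"
        unfolding w_def using t q diameter_ge_0[OF bV[OF i]] by (intro powr_mono2) auto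
      then have le: "q powr t * diameter (V i) powr t \<le> w (U i)"
        using q diameter_ge_0[OF bV[OF i]] by (simp add: powr_mult)
      \<comment> \<open>The factor \<open>card J\<close> saved by the cheapest piece pays for the
        factor \<open>q powr t\<close> lost in pulling back.\<close>
      have "diameter (V i) powr t \<le> (real (card J) * q powr t) * diameter (V i) powr t"
        using mult_right_mono[OF q(2), of "diameter (V i) powr t"] by simp
      also have "\<dots> \<le> real (card J) * w (U i)"
        using mult_left_mono[OF le, of "real (card J)"] by (simp add: mult.assoc)
      finally show "diameter (V i) powr t \<le> real (card J) * w (U i)" .
    qed
    also have "\<dots> \<le> (\<Sum>i\<in>I. w (U i))" using j(2) by (simp add: sum_distrib_left)
    finally show ?thesis by (simp add: w_def)
  qed
qed

text \<open>A cover of cost below \<open>e / 2\<close> is fattened to open sets at an extra cost of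
  at most \<open>e / 2\<close>; compactness then leaves finitely many of them.\<close>

lemma hausdorff_null_finite_cover:
  fixes F :: "'a::metric_space set"
  assumes F: "compact F" and t: "0 < t" and null: "hausdorff_measure t F = 0" and e: "0 < e"
  obtains I :: "nat set" and U where "finite I" "F \<subseteq> (\<Union>i\<in>I. U i)" "\<And>i. bounded (U i)"
    "(\<Sum>i\<in>I. diameter (U i) powr t) < e"
proof -
  have "hausdorff_premeasure t 1 F = 0"
    using hausdorff_premeasure_le_measure[of 1 t F] null by simp
  then have "hausdorff_premeasure t 1 F < ennreal (e / 2)" using e by simp
  then obtain U where U: "F \<subseteq> (\<Union>i. U i)" "\<And>i. bounded (U i)" "\<And>i. diameter (U i) \<le> 1"
    "(\<Sum>i. hausdorff_weight t (U i)) < ennreal (e / 2)"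
    by (rule hausdorff_premeasure_cover) (rule that)
  \<comment> \<open>Continuity of the power in its base; as \<open>t > 0\<close>, this includes sets
    of diameter 0.\<close>
  have "\<exists>\<eta>>0. (diameter (U i) + 2 * \<eta>) powr t \<le> diameter (U i) powr t + e/2 * (1/2) ^ Suc i" for i
  proof -
    have "((\<lambda>\<eta>. (diameter (U i) + 2 * \<eta>) powr t) \<longlongrightarrow> (diameter (U i) + 2 * 0) powr t) (at_right 0)"
    proof (intro tendsto_powr2 tendsto_intros)
      show "\<forall>\<^sub>F \<eta> in at_right 0. 0 \<le> diameter (U i) + 2 * \<eta>"
        using diameter_ge_0[OF U(2)[of i]]
        by (auto intro!: eventually_at_rightI[of 0 1] add_nonneg_nonneg)
    qed (use t in auto)
    then have "\<forall>\<^sub>F \<eta> in at_right 0. (diameter (U i) + 2 * \<eta>) powr t < diameter (U i) powr t + e/2 * (1/2) ^ Suc i"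
      using e by (intro order_tendstoD(2)) auto
    moreover have "\<forall>\<^sub>F \<eta> in at_right 0. 0 < (\<eta>::real)" by (rule eventually_at_right_less)
    ultimately have "\<forall>\<^sub>F \<eta> in at_right 0. 0 < \<eta> \<and>
        (diameter (U i) + 2 * \<eta>) powr t < diameter (U i) powr t + e/2 * (1/2) ^ Suc i"
      by eventually_elim auto
    then obtain \<eta> where "0 < \<eta>"
      "(diameter (U i) + 2 * \<eta>) powr t < diameter (U i) powr t + e/2 * (1/2) ^ Suc i"
      using eventually_happens'[OF trivial_limit_at_right_real] by blast
    then show ?thesis by (intro exI[of _ \<eta>]) simp
  qed
  then have "\<exists>\<eta>. \<forall>i. 0 < \<eta> i \<and>
      (diameter (U i) + 2 * \<eta> i) powr t \<le> diameter (U i) powr t + e/2 * (1/2) ^ Suc i"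
    by (intro choice) blast
  then obtain \<eta> where \<eta>: "\<And>i. 0 < \<eta> i"
    "\<And>i. (diameter (U i) + 2 * \<eta> i) powr t \<le> diameter (U i) powr t + e/2 * (1/2) ^ Suc i"
    by blast
  define V where "V i = (\<Union>x\<in>U i. ball x (\<eta> i))" for i
  have dV: "dist x y \<le> diameter (U i) + 2 * \<eta> i" if xy: "x \<in> V i" "y \<in> V i" for i x y
  proof -
    obtain a b where ab: "a \<in> U i" "b \<in> U i" "dist a x < \<eta> i" "dist b y < \<eta> i"
      using xy by (auto simp: V_def)
    have "dist x y \<le> dist a x + dist a b + dist b y"
      by metric
    moreover have "dist a b \<le> diameter (U i)" using U(2) ab by (intro diameter_bounded_bound)
    ultimately show ?thesis using ab by linarith
  qed
  have bV: "bounded (V i)" for i unfolding bounded_two_points using dV by blast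
  have wV: "diameter (V i) powr t \<le> diameter (U i) powr t + e/2 * (1/2) ^ Suc i" for i
  proof -
    have "diameter (V i) \<le> diameter (U i) + 2 * \<eta> i"
      using dV diameter_ge_0[OF U(2)[of i]] \<eta>(1)[of i] by (intro diameter_le_dist) auto
    then have "diameter (V i) powr t \<le> (diameter (U i) + 2 * \<eta> i) powr t"
      using t diameter_ge_0[OF bV] by (intro powr_mono2) auto
    then show ?thesis using \<eta>(2) order_trans by blast
  qed
  have "F \<subseteq> (\<Union>i. V i)"
  proof
    fix x assume "x \<in> F"
    then obtain i where "x \<in> U i" using U(1) by blast
    then have "x \<in> V i" using \<eta>(1)[of i] by (auto simp: V_def intro!: bexI[of _ x])
    then show "x \<in> (\<Union>i. V i)" by blast
  qed
  moreover have "open (V i)" for i by (auto simp: V_def)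
  ultimately obtain I where I: "finite I" "F \<subseteq> (\<Union>i\<in>I. V i)"
    using compactE_image[OF F, of UNIV V] by auto
  have "summable (\<lambda>i. diameter (U i) powr t)"
    using U(4) t by (intro summable_suminf_not_top) (auto simp: hausdorff_weight_pos)
  then have "(\<Sum>i. hausdorff_weight t (U i)) = ennreal (\<Sum>i. diameter (U i) powr t)"
    using t by (simp add: hausdorff_weight_pos suminf_ennreal2)
  then have small: "(\<Sum>i. diameter (U i) powr t) < e / 2"
    using U(4) e by (simp add: ennreal_less_iff suminf_nonneg \<open>summable _\<close>)
  have "(\<Sum>i\<in>I. diameter (V i) powr t) \<le> (\<Sum>i\<in>I. diameter (U i) powr t) + (\<Sum>i\<in>I. e/2 * (1/2) ^ Suc i)"
    unfolding sum.distrib[symmetric] by (intro sum_mono wV)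
  also have "\<dots> \<le> (\<Sum>i. diameter (U i) powr t) + e / 2"
  proof (rule add_mono)
    show "(\<Sum>i\<in>I. diameter (U i) powr t) \<le> (\<Sum>i. diameter (U i) powr t)"
      by (intro sum_le_suminf \<open>summable _\<close> I) auto
    have s: "(\<lambda>i. e/2 * (1/2) ^ Suc i) sums (e/2 * 1)"
      by (intro sums_mult power_half_series)
    then show "(\<Sum>i\<in>I. e/2 * (1/2) ^ Suc i) \<le> e / 2"
      using sum_le_suminf[OF sums_summable[OF s] I(1)] e sums_unique[OF s] by auto
  qed
  also have "\<dots> < e" using small by simp
  finally show thesis using that[OF I bV] by blast
qed

text \<open>The infimum defining the dimension is approached, possibly attained, by exponents of
  vanishing measure, and 0 is never one of them for a non-empty set.\<close>

lemma hausdorff_dim_less: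
  assumes "F \<noteq> {}" "ereal s = hausdorff_dim F" "s < u"
  obtains t where "0 < t" "s \<le> t" "t < u" "hausdorff_measure t F = 0"
proof -
  have "Inf (ereal ` {t. 0 \<le> t \<and> hausdorff_measure t F = 0}) < ereal u"
    using assms unfolding hausdorff_dim_def by (metis less_ereal.simps(1))
  then obtain t where t: "0 \<le> t" "hausdorff_measure t F = 0" "t < u"
    unfolding Inf_less_iff by auto
  moreover have "s \<le> t"
  proof -
    have "ereal s \<le> ereal t" unfolding assms(2) hausdorff_dim_def using t by (intro Inf_lower) auto
    then show ?thesis by simp
  qed
  moreover have "t \<noteq> 0" using hausdorff_measure_0_pos[OF assms(1)] t(2) by auto
  ultimately show thesis by (intro that[of t]) auto
qed

lemma hausdorff_dim_nonneg: "0 \<le> hausdorff_dim A"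
  unfolding hausdorff_dim_def by (rule Inf_greatest) auto

definition embeds_in_balls :: "real \<Rightarrow> 'a::metric_space set \<Rightarrow> bool" where
  "embeds_in_balls D F \<longleftrightarrow> (\<forall>x\<in>F. \<forall>r. 0 < r \<and> r \<le> diameter F \<longrightarrow>
     (\<exists>g. g ` F \<subseteq> F \<inter> cball x r \<and>
        (\<forall>y\<in>F. \<forall>z\<in>F. inverse D * r * dist y z \<le> dist (g y) (g z) \<and>
                     dist (g y) (g z) \<le> D * r * dist y z)))"

lemma embeds_in_ballsE:
  assumes "embeds_in_balls D F" "x \<in> F" "0 < r" "r \<le> diameter F"
  obtains g where "g ` F \<subseteq> F" "g ` F \<subseteq> cball x r"
    "\<And>y z. y \<in> F \<Longrightarrow> z \<in> F \<Longrightarrow> r / D * dist y z \<le> dist (g y) (g z)"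
    "\<And>y z. y \<in> F \<Longrightarrow> z \<in> F \<Longrightarrow> dist (g y) (g z) \<le> D * r * dist y z"
proof -
  obtain g where "g ` F \<subseteq> F \<inter> cball x r \<and> (\<forall>y\<in>F. \<forall>z\<in>F. inverse D * r * dist y z \<le> dist (g y) (g z) \<and>
      dist (g y) (g z) \<le> D * r * dist y z)"
    using assms unfolding embeds_in_balls_def by blast
  then show thesis by (intro that[of g]) (auto simp: field_simps)
qed

text \<open>If the product exceeded 1, it would do so at some nearby exponent \<open>t\<close> where
  the measure of \<open>F\<close> vanishes. Finite covers of arbitrarily small cost then exist,
  whereas the copies of \<open>F\<close> around the points of \<open>S\<close> force every finite
  cover to cost at least \<open>r powr t\<close>.\<close>

lemma separated_card_bound:
  fixes F :: "'a::metric_space set"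
  assumes F: "F \<noteq> {}" "compact F" and D: "1 \<le> D" "embeds_in_balls D F"
    and dim: "ereal s = hausdorff_dim F"
    and S: "finite S" "S \<subseteq> F" "2 \<le> card S"
    and r: "0 < r" "r \<le> diameter F"
    and sep: "pairwise (\<lambda>x y. 3 * r \<le> dist x y) S"
  shows "real (card S) * (r / D) powr s \<le> 1"
proof (rule ccontr)
  assume "\<not> ?thesis"
  then have gt: "1 < real (card S) * (r / D) powr s" by simp
  have "((\<lambda>t. real (card S) * (r / D) powr t) \<longlongrightarrow> real (card S) * (r / D) powr s) (at_right s)"
    using r D by (intro tendsto_intros) auto
  then have "\<forall>\<^sub>F t in at_right s. 1 < real (card S) * (r / D) powr t"
    using gt by (rule order_tendstoD(1))
  then obtain u where u: "s < u" "\<And>t. s < t \<Longrightarrow> t < u \<Longrightarrow> 1 < real (card S) * (r / D) powr t"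
    unfolding eventually_at_right_field by blast
  obtain t where t: "0 < t" "s \<le> t" "t < u" "hausdorff_measure t F = 0"
    using hausdorff_dim_less[OF F(1) dim u(1)] by blast
  \<comment> \<open>The exponent \<open>t\<close> may be \<open>s\<close> itself, where the assumed
    inequality applies directly.\<close>
  have q: "1 \<le> real (card S) * (r / D) powr t"
    using u(2)[of t] gt t by (cases "t = s") auto
  have "\<forall>x\<in>S. \<exists>g. g ` F \<subseteq> F \<and> g ` F \<subseteq> cball x r \<and>
      (\<forall>y\<in>F. \<forall>z\<in>F. r / D * dist y z \<le> dist (g y) (g z))"
    by (meson embeds_in_ballsE[OF D(2) _ r] S(2) subsetD)
  then obtain g where g: "\<And>x. x \<in> S \<Longrightarrow> g x ` F \<subseteq> F" "\<And>x. x \<in> S \<Longrightarrow> g x ` F \<subseteq> cball x r"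
      "\<And>x y z. x \<in> S \<Longrightarrow> y \<in> F \<Longrightarrow> z \<in> F \<Longrightarrow> r / D * dist y z \<le> dist (g x y) (g x z)"
    by metis
  \<comment> \<open>Of the separation \<open>3 * r\<close> each of the two balls uses up at most
    \<open>r\<close>.\<close>
  have gsep: "r \<le> dist (g x a) (g y b)" if "x \<in> S" "y \<in> S" "x \<noteq> y" "a \<in> F" "b \<in> F" for x y a b
  proof -
    have "dist x (g x a) \<le> r" "dist y (g y b) \<le> r" using g(2) that by fastforce+
    moreover have "3 * r \<le> dist x y" using pairwiseD[OF sep] that by blast
    moreover have "dist x y \<le> dist x (g x a) + dist (g x a) (g y b) + dist y (g y b)"
      by (metis add_mono_thms_linordered_semiring(3) dist_commute dist_triangle order_trans)
    ultimately show ?thesis by linarith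
  qed
  obtain I :: "nat set" and U where IU: "finite I" "F \<subseteq> (\<Union>i\<in>I. U i)" "\<And>i. bounded (U i)"
    "(\<Sum>i\<in>I. diameter (U i) powr t) < r powr t"
    using hausdorff_null_finite_cover[OF F(2) t(1) t(4), of "r powr t"] r by auto
  have "r powr t \<le> (\<Sum>i\<in>I. diameter (U i) powr t)"
    using r D by (intro self_embedding_cover_bound[OF IU(1) F(1) IU(2,3) S(1,3) t(1) _ q r(1) g(1) g(3) gsep]) simp_all
  then show False using IU(4) by simp
qed

section \<open>Families of dense balls\<close>

text \<open>The bound on cardinalities gives a separated set of largest size; a point farther than
  \<open>r\<close> from all of it could still be added.\<close>

lemma maximal_separated_subset:
  fixes A :: "'a::metric_space set"
  assumes r: "0 < r"
    and bound: "\<And>S. finite S \<Longrightarrow> S \<subseteq> A \<Longrightarrow> pairwise (\<lambda>x y. r \<le> dist x y) S \<Longrightarrow> card S \<le> N"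
  obtains S where "finite S" "S \<subseteq> A" "pairwise (\<lambda>x y. r \<le> dist x y) S"
    "A \<subseteq> (\<Union>x\<in>S. cball x r)"
proof -
  define P where "P S \<longleftrightarrow> finite S \<and> S \<subseteq> A \<and> pairwise (\<lambda>x y. r \<le> dist x y) S" for S
  have "P {}" by (simp add: P_def)
  moreover have "\<forall>S. P S \<longrightarrow> card S < Suc N" using bound by (auto simp: P_def less_Suc_eq_le)
  ultimately have "\<exists>S. P S \<and> (\<forall>T. P T \<longrightarrow> card T \<le> card S)"
    by (rule ex_has_greatest_nat)
  then obtain S where S: "P S" "\<And>T. P T \<Longrightarrow> card T \<le> card S" by blast
  have "A \<subseteq> (\<Union>x\<in>S. cball x r)"
  proof (rule ccontr)
    assume "\<not> ?thesis"
    then obtain a where "a \<in> A" "a \<notin> (\<Union>x\<in>S. cball x r)" by blast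
    then have a: "a \<in> A" "\<And>x. x \<in> S \<Longrightarrow> r < dist x a" by (auto simp: not_le)
    then have "a \<notin> S" using r by force
    have "P (insert a S)"
      using S(1) a unfolding P_def by (auto simp: pairwise_insert dist_commute less_imp_le)
    then have "card (insert a S) \<le> card S" by (rule S(2))
    then show False using S(1) \<open>a \<notin> S\<close> by (simp add: P_def)
  qed
  then show thesis using that[of S] S(1) by (auto simp: P_def)
qed

text \<open>Finite families over an arbitrary index type are easier to assemble than sequences. A
  single ball becomes a sequence by padding with empty sets, which weigh nothing.\<close>

lemma hausdorff_premeasure_cballs:
  fixes A :: "'a::metric_space set"
  assumes s: "0 < s" and I: "finite I" and A: "A \<subseteq> (\<Union>i\<in>I. cball (c i) (R i))"
    and R: "\<And>i. i \<in> I \<Longrightarrow> 0 \<le> R i" "\<And>i. i \<in> I \<Longrightarrow> 2 * R i \<le> \<delta>" and \<delta>: "0 \<le> \<delta>"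
  shows "hausdorff_premeasure s \<delta> A \<le> ennreal (\<Sum>i\<in>I. (2 * R i) powr s)"
  using I A R
proof (induction I arbitrary: A rule: finite_induct)
  case empty
  then show ?case using \<delta> by simp
next
  case (insert i I)
  let ?B = "cball (c i) (R i)"
  have diam: "diameter ?B \<le> 2 * R i"
  proof (rule diameter_le_dist)
    fix x y assume "x \<in> ?B" "y \<in> ?B"
    then show "dist x y \<le> 2 * R i" using dist_triangle3[of x y "c i"] by simp
  qed (use insert.prems in simp)
  have "hausdorff_premeasure s \<delta> ?B \<le> (\<Sum>n. hausdorff_weight s (if n = 0 then ?B else {}))"
  proof (rule hausdorff_premeasure_le)
    show "?B \<subseteq> (\<Union>n::nat. if n = 0 then ?B else {})" by (auto intro: exI[of _ "0::nat"])
    show "diameter (if n = 0 then ?B else {}) \<le> \<delta>" for n :: nat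
      using diam insert.prems(3)[of i] \<delta> by simp
  qed simp
  also have "\<dots> = hausdorff_weight s ?B"
    by (subst suminf_finite[of "{0}"]) auto
  also have "\<dots> \<le> ennreal ((2 * R i) powr s)"
    using s diam by (auto simp: hausdorff_weight_pos intro!: ennreal_leI powr_mono2 diameter_ge_0)
  finally have B: "hausdorff_premeasure s \<delta> ?B \<le> ennreal ((2 * R i) powr s)" .
  have "hausdorff_premeasure s \<delta> (A - ?B) \<le> ennreal (\<Sum>i\<in>I. (2 * R i) powr s)"
    using insert.prems by (intro insert.IH) auto
  then have "hausdorff_premeasure s \<delta> (?B \<union> (A - ?B)) \<le>
      ennreal ((2 * R i) powr s) + ennreal (\<Sum>i\<in>I. (2 * R i) powr s)"
    by (intro order_trans[OF hausdorff_premeasure_Un[OF \<delta>]] add_mono B)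
  also have "\<dots> = ennreal (\<Sum>i\<in>insert i I. (2 * R i) powr s)"
    using insert.hyps by (simp add: ennreal_plus sum_nonneg)
  finally show ?case
    using hausdorff_premeasure_mono[of A "?B \<union> (A - ?B)" s \<delta>] by (auto intro: order_trans)
qed

text \<open>
  Take a disjoint family that is almost maximal for the sum of the \<open>t powr s\<close>. If the sum is small, the
  doubled balls leave a part of \<open>F\<close> that is expensive to cover, and adding one ball of \<open>\<Delta>\<close>
  near each point of a fine maximal separated subset of it increases the sum by at least a constant
  \<open>\<eta>\<close> that does not depend on the fineness.
\<close>

lemma dense_balls_family:
  fixes F :: "'a::metric_space set" and \<Delta> :: "('a \<times> real) set"
  assumes s: "0 < s" and \<theta>: "0 < \<theta>" and d: "0 < d" and \<delta>: "0 < \<delta>" and m: "0 < m"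
    and cover: "\<And>(I :: ('a \<times> real) set) R. finite I \<Longrightarrow> F \<subseteq> (\<Union>i\<in>I. cball (fst i) (R i)) \<Longrightarrow>
      (\<And>i. i \<in> I \<Longrightarrow> 0 \<le> R i \<and> 2 * R i \<le> \<delta>) \<Longrightarrow> m \<le> (\<Sum>i\<in>I. (2 * R i) powr s)"
    and pack: "\<And>r. 0 < r \<Longrightarrow> \<exists>N. \<forall>S. finite S \<and> S \<subseteq> F \<and>
      pairwise (\<lambda>x y. r \<le> dist x y) S \<longrightarrow> card S \<le> N"
    and \<Delta>: "\<And>z t. (z, t) \<in> \<Delta> \<Longrightarrow> 0 < t"
    and dense: "\<And>y \<rho>. y \<in> F \<Longrightarrow> 0 < \<rho> \<Longrightarrow> \<rho> \<le> d \<Longrightarrow> \<exists>z. dist y z \<le> \<rho> \<and> (z, \<theta> * \<rho>) \<in> \<Delta>"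
  shows "\<exists>T. finite T \<and> T \<subseteq> \<Delta> \<and> disjoint_family_on (\<lambda>(z, t). cball z t) T \<and>
    m / (2 * 4 powr s) \<le> (\<Sum>(z, t)\<in>T. t powr s)"
proof -
  \<comment> \<open>The bound \<open>4 * snd i \<le> \<delta>\<close> makes the doubled balls, of
    diameter at most \<open>4 * snd i\<close>, admissible in covers at scale
    \<open>\<delta>\<close>.\<close>
  define P where "P T \<longleftrightarrow> finite T \<and> T \<subseteq> \<Delta> \<and> (\<forall>i\<in>T. 4 * snd i \<le> \<delta>) \<and>
    disjoint_family_on (\<lambda>(z, t). cball z t) T" for T :: "('a \<times> real) set"
  define w where "w T = (\<Sum>(z, t)\<in>T. t powr s)" for T :: "('a \<times> real) set"
  \<comment> \<open>Chosen so that below \<open>c0\<close> the doubled balls, with their factor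
    \<open>4 powr s\<close>, account for at most \<open>m / 2\<close>.\<close>
  define c0 where "c0 = m / (2 * 4 powr s)"
  have "\<exists>T. P T \<and> c0 \<le> w T"
  proof (rule ccontr)
    assume contra: "\<not> ?thesis"
    then have small: "w T < c0" if "P T" for T using that by force
    \<comment> \<open>The fraction \<open>\<theta> / (6 * (1 + \<theta>))\<close> will be the ratio
      of the radius of a new ball to \<open>\<mu>\<close>, whatever \<open>\<mu>\<close> turns out
      to be.\<close>
    define \<eta> where "\<eta> = m / 2 * (\<theta> / (6 * (1 + \<theta>))) powr s"
    have \<eta>: "0 < \<eta>" using m \<theta> by (simp add: \<eta>_def)
    have "P {}" by (simp add: P_def disjoint_family_on_def)
    have bdd: "bdd_above (w ` {T. P T})" using small by (auto intro!: bdd_aboveI[of _ c0] less_imp_le)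
    define w_sup where "w_sup = (SUP T\<in>{T. P T}. w T)"
    have "w_sup - \<eta> < w_sup" using \<eta> by simp
    then obtain T where T: "P T" "w_sup - \<eta> < w T"
      unfolding w_sup_def using less_cSUP_iff[OF _ bdd, of "w_sup - \<eta>"] \<open>P {}\<close> w_sup_def by blast
    have Tfin: "finite T" and T\<Delta>: "T \<subseteq> \<Delta>" and T4: "\<And>i. i \<in> T \<Longrightarrow> 4 * snd i \<le> \<delta>"
      and Tdisj: "disjoint_family_on (\<lambda>(z, t). cball z t) T"
      using T(1) by (auto simp: P_def)
    have Tpos: "0 < snd i" if "i \<in> T" for i using \<Delta>[of "fst i" "snd i"] that T\<Delta> by auto
    define A where "A = F - (\<Union>i\<in>T. cball (fst i) (2 * snd i))"
    \<comment> \<open>New balls must be small against the smallest radius in \<open>T\<close>;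
      \<open>\<delta>\<close> and \<open>d\<close> make them admissible for \<open>cover\<close> and
      \<open>dense\<close> and keep the set non-empty.\<close>
    define \<mu> where "\<mu> = Min (insert \<delta> (insert d (snd ` T)))"
    have \<mu>: "0 < \<mu>" "\<mu> \<le> \<delta>" "\<mu> \<le> d" "\<And>i. i \<in> T \<Longrightarrow> \<mu> \<le> snd i"
      using Tfin Tpos d \<delta> unfolding \<mu>_def by (auto intro: Min_le simp del: Min_insert)
    define \<rho> where "\<rho> = \<mu> / (6 * (1 + \<theta>))"
    have \<rho>: "0 < \<rho>" using \<mu> \<theta> by (simp add: \<rho>_def)
    have \<rho>_\<mu>: "6 * (1 + \<theta>) * \<rho> = \<mu>" using \<theta> by (simp add: \<rho>_def)
    have \<rho>_\<mu>': "6 * \<rho> + 6 * (\<theta> * \<rho>) = \<mu>" using \<rho>_\<mu> by (simp add: algebra_simps)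
    have \<theta>\<rho>: "0 < \<theta> * \<rho>" using \<theta> \<rho> by simp
    \<comment> \<open>New centres lie within \<open>\<rho>\<close> of points of \<open>S\<close>, so
      disjointness of balls of radius \<open>\<theta> * \<rho>\<close> needs a separation above
      \<open>2 * (1 + \<theta>) * \<rho>\<close>; the factor 3 leaves room.\<close>
    define r where "r = 3 * (1 + \<theta>) * \<rho>"
    have r1: "r = 3 * \<rho> + 3 * (\<theta> * \<rho>)" by (simp add: r_def algebra_simps)
    then have r: "r = 3 * \<rho> + 3 * (\<theta> * \<rho>)" "0 < r" "2 * r = \<mu>"
      using \<rho> \<theta>\<rho> \<rho>_\<mu>' by linarith+
    obtain N where N: "\<forall>S. finite S \<and> S \<subseteq> F \<and>
      pairwise (\<lambda>x y. r \<le> dist x y) S \<longrightarrow> card S \<le> N"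
      using pack[OF r(2)] by (rule exE)
    have "A \<subseteq> F" by (auto simp: A_def)
    have N_A: "card S \<le> N" if "finite S" "S \<subseteq> A"
      "pairwise (\<lambda>x y. r \<le> dist x y) S" for S
      using N that \<open>A \<subseteq> F\<close> by blast
    obtain S where S: "finite S" "S \<subseteq> A"
      "pairwise (\<lambda>x y. r \<le> dist x y) S" "A \<subseteq> (\<Union>x\<in>S. cball x r)"
      using maximal_separated_subset[OF r(2), of A N] N_A by blast
    have "\<forall>y\<in>S. \<exists>z. dist y z \<le> \<rho> \<and> (z, \<theta> * \<rho>) \<in> \<Delta>"
    proof
      fix y assume "y \<in> S"
      then have "y \<in> F" using S(2) by (auto simp: A_def)
      moreover have "\<rho> \<le> d" using \<mu>(3) \<rho>_\<mu>' \<rho> \<theta>\<rho> by linarith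
      ultimately show "\<exists>z. dist y z \<le> \<rho> \<and> (z, \<theta> * \<rho>) \<in> \<Delta>" using dense \<rho> by blast
    qed
    then obtain Z where Z: "\<And>y. y \<in> S \<Longrightarrow> dist y (Z y) \<le> \<rho>" "\<And>y. y \<in> S \<Longrightarrow> (Z y, \<theta> * \<rho>) \<in> \<Delta>"
      by metis
    define E where "E = (\<lambda>y. (Z y, \<theta> * \<rho>)) ` S"
    have E_disj: "cball (Z x) (\<theta> * \<rho>) \<inter> cball (Z y) (\<theta> * \<rho>) = {}"
      if xy: "x \<in> S" "y \<in> S" "x \<noteq> y" for x y
    proof (rule ccontr)
      assume "\<not> ?thesis"
      then obtain p where p: "dist (Z x) p \<le> \<theta> * \<rho>" "dist (Z y) p \<le> \<theta> * \<rho>" by auto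
      have "dist x y \<le> dist x (Z x) + dist (Z x) p + dist (Z y) p + dist y (Z y)"
        by metric
      then show False using p Z(1)[OF xy(1)] Z(1)[OF xy(2)] pairwiseD[OF S(3) xy] r(1) \<rho> \<theta>\<rho> by linarith
    qed
    \<comment> \<open>The point \<open>y\<close> is outside the doubled ball, and the new ball
      reaches at most \<open>(1 + \<theta>) * \<rho> = \<mu> / 6\<close> from \<open>y\<close>,
      which is less than \<open>snd i\<close>.\<close>
    have TE_disj: "cball (Z y) (\<theta> * \<rho>) \<inter> cball (fst i) (snd i) = {}" if y: "y \<in> S" and i: "i \<in> T" for y i
    proof (rule ccontr)
      assume "\<not> ?thesis"
      then obtain p where p: "dist (Z y) p \<le> \<theta> * \<rho>" "dist (fst i) p \<le> snd i" by auto
      have "dist (fst i) y \<le> dist (fst i) p + dist (Z y) p + dist y (Z y)" by metric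
      also have "\<dots> \<le> 2 * snd i" using p Z(1)[OF y] \<mu>(4)[OF i] \<rho>_\<mu>' \<rho> \<theta>\<rho> by linarith
      finally show False using y S(2) i by (auto simp: A_def)
    qed
    have inj: "inj_on (\<lambda>y. (Z y, \<theta> * \<rho>)) S"
    proof (rule inj_onI, rule ccontr)
      fix x y assume "x \<in> S" "y \<in> S" "(Z x, \<theta> * \<rho>) = (Z y, \<theta> * \<rho>)" "x \<noteq> y"
      then show False using E_disj[of x y] \<theta>\<rho> by (auto simp: not_le)
    qed
    have "T \<inter> E = {}"
    proof (rule ccontr)
      assume "\<not> ?thesis"
      then obtain y where "y \<in> S" "(Z y, \<theta> * \<rho>) \<in> T" by (auto simp: E_def)
      then show False using TE_disj[of y "(Z y, \<theta> * \<rho>)"] \<theta>\<rho> by (auto simp: not_le)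
    qed
    then have w_Un: "w (T \<union> E) = w T + w E"
      unfolding w_def using Tfin S(1) by (intro sum.union_disjoint) (auto simp: E_def)
    have wE: "w E = card S * (\<theta> * \<rho>) powr s"
      unfolding w_def E_def by (subst sum.reindex[OF inj]) simp
    have "P (T \<union> E)"
      unfolding P_def
    proof (intro conjI)
      show "finite (T \<union> E)" using Tfin S(1) by (simp add: E_def)
      show "T \<union> E \<subseteq> \<Delta>" using T\<Delta> Z by (auto simp: E_def)
      have "4 * (\<theta> * \<rho>) \<le> \<delta>" using \<rho>_\<mu>' \<mu>(2) \<rho> \<theta>\<rho> by linarith
      then show "\<forall>i\<in>T \<union> E. 4 * snd i \<le> \<delta>" using T4 by (auto simp: E_def)
      let ?b = "\<lambda>(z, t). cball z t"
      have TT: "?b i \<inter> ?b j = {}" if "i \<in> T" "j \<in> T" "i \<noteq> j" for i j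
        using disjoint_family_onD[OF Tdisj] that by blast
      have EE: "?b i \<inter> ?b j = {}" if ij: "i \<in> E" "j \<in> E" "i \<noteq> j" for i j
      proof -
        obtain x y where "x \<in> S" "y \<in> S" "i = (Z x, \<theta> * \<rho>)" "j = (Z y, \<theta> * \<rho>)"
          using ij by (auto simp: E_def)
        then show ?thesis using E_disj[of x y] ij(3) by (cases "x = y") simp_all
      qed
      have TE: "?b i \<inter> ?b j = {}" if ij: "i \<in> T" "j \<in> E" for i j
      proof -
        obtain y where "y \<in> S" "j = (Z y, \<theta> * \<rho>)" using ij by (auto simp: E_def)
        then show ?thesis using TE_disj[of y i] ij by (simp add: case_prod_unfold Int_commute)
      qed
      show "disjoint_family_on ?b (T \<union> E)"
        unfolding disjoint_family_on_def
      proof (intro ballI impI)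
        fix i j assume "i \<in> T \<union> E" "j \<in> T \<union> E" "i \<noteq> j"
        then show "?b i \<inter> ?b j = {}"
          using TT[of i j] EE[of i j] TE[of i j] TE[of j i] Int_commute[of "?b i" "?b j"] by auto
      qed
    qed
    then have "w (T \<union> E) \<le> w_sup"
      unfolding w_sup_def using bdd by (intro cSUP_upper) auto
    then have "w E < \<eta>" using w_Un T(2) by linarith
    moreover have "\<eta> \<le> w E"
    proof -
      \<comment> \<open>the index \<open>(y, 0)\<close> of a new ball cannot clash with \<open>T\<close>, where radii are positive\<close>
      define J where "J = T \<union> (\<lambda>y. (y, 0)) ` S"
      define R where "R i = (if i \<in> T then 2 * snd i else r)" for i :: "'a \<times> real"
      have disj: "T \<inter> (\<lambda>y. (y, 0)) ` S = {}" using Tpos by force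
      have R_S: "R (y, 0) = r" if "y \<in> S" for y using Tpos by (force simp: R_def)
      \<comment> \<open>The doubled balls of \<open>T\<close> pay at most half of \<open>m\<close>,
        so the balls of diameter at most \<open>\<mu>\<close> around \<open>S\<close> must pay the
        rest; this bounds \<open>card S\<close> from below.\<close>
      have "m \<le> (\<Sum>i\<in>J. (2 * R i) powr s)"
      proof (rule cover)
        show "finite J" using Tfin S(1) by (simp add: J_def)
        show "F \<subseteq> (\<Union>i\<in>J. cball (fst i) (R i))"
        proof
          fix x assume x: "x \<in> F"
          show "x \<in> (\<Union>i\<in>J. cball (fst i) (R i))"
          proof (cases "x \<in> A")
            case True
            then obtain y where "y \<in> S" "x \<in> cball y r" using S(4) by blast
            then show ?thesis using R_S unfolding J_def by (auto intro!: bexI[of _ "(y, 0)"])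
          next
            case False
            then obtain i where "i \<in> T" "x \<in> cball (fst i) (2 * snd i)" using x by (auto simp: A_def)
            then show ?thesis unfolding J_def by (intro UN_I[of i]) (auto simp: R_def)
          qed
        qed
        show "0 \<le> R i \<and> 2 * R i \<le> \<delta>" if "i \<in> J" for i
          using that Tpos T4 r \<mu>(2) by (auto simp: R_def less_imp_le)
      qed
      also have "\<dots> = (\<Sum>i\<in>T. (2 * R i) powr s) + (\<Sum>i\<in>(\<lambda>y. (y, 0)) ` S. (2 * R i) powr s)"
        unfolding J_def using Tfin S(1) disj by (intro sum.union_disjoint) auto
      also have "(\<Sum>i\<in>(\<lambda>y. (y, 0)) ` S. (2 * R i) powr s) = card S * \<mu> powr s"
        using R_S r(3) by (subst sum.reindex) (auto simp: inj_on_def)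
      also have "(\<Sum>i\<in>T. (2 * R i) powr s) = 4 powr s * w T"
        unfolding w_def sum_distrib_left R_def
        using Tpos by (intro sum.cong) (auto simp: powr_mult[symmetric] less_imp_le)
      also have "4 powr s * w T \<le> m / 2"
        using small[OF T(1)] by (simp add: c0_def field_simps)
      finally have "m / 2 \<le> card S * \<mu> powr s" by simp
      then have "\<eta> \<le> (card S * \<mu> powr s) * (\<theta> / (6 * (1 + \<theta>))) powr s"
        unfolding \<eta>_def by (intro mult_right_mono) auto
      also have "\<dots> = card S * (\<mu> * (\<theta> / (6 * (1 + \<theta>)))) powr s"
        using \<mu>(1) \<theta> by (subst powr_mult) (simp_all only: mult.assoc)
      also have "\<mu> * (\<theta> / (6 * (1 + \<theta>))) = \<theta> * \<rho>" by (simp add: \<rho>_def)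
      finally show ?thesis by (simp add: wE)
    qed
    ultimately show False by simp
  qed
  then obtain T where "P T" "c0 \<le> w T" by blast
  then show ?thesis unfolding P_def w_def c0_def by (intro exI[of _ T]) simp
qed

section \<open>Ahlfors regularity\<close>

lemma radon_measure_finite:
  fixes \<mu> :: "'a::{second_countable_topology, complete_space} measure"
  assumes "sets \<mu> = sets borel" "emeasure \<mu> (space \<mu>) < \<infinity>"
  shows "radon_measure \<mu>"
  unfolding radon_measure_def
proof (intro conjI allI impI ballI)
  have fin: "emeasure \<mu> (space \<mu>) \<noteq> \<infinity>" using assms(2) by simp
  show "emeasure \<mu> K < \<infinity>" for K
    using emeasure_space[of \<mu> K] assms(2) by (rule le_less_trans)
  show "emeasure \<mu> B = (INF U\<in>{U. open U \<and> B \<subseteq> U}. emeasure \<mu> U)" if "B \<in> sets borel" for B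
    using outer_regular[OF assms(1) fin that] by (simp add: conj_commute)
  show "emeasure \<mu> U = (SUP K\<in>{K. compact K \<and> K \<subseteq> U}. emeasure \<mu> K)" if "open U" for U
    using inner_regular[OF assms(1) fin, of U] that by (simp add: conj_commute)
qed (rule assms(1))

lemma ahlfors_regularI:
  assumes "radon_measure \<mu>" "AE x in \<mu>. x \<in> A" "0 < a"
    and "\<And>x r. x \<in> A \<Longrightarrow> 0 < r \<Longrightarrow> (bounded A \<Longrightarrow> r < diameter A) \<Longrightarrow>
      ennreal (a * r powr s) \<le> emeasure \<mu> (cball x r)"
    and "\<And>x r. x \<in> A \<Longrightarrow> 0 < r \<Longrightarrow> (bounded A \<Longrightarrow> r < diameter A) \<Longrightarrow>
      emeasure \<mu> (cball x r) \<le> ennreal (K * r powr s)"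
  shows "ahlfors_regular s A"
proof -
  define C where "C = max 1 (max (inverse a) K)"
  have C: "1 \<le> C" "K \<le> C" "inverse C \<le> a"
    using \<open>0 < a\<close> le_imp_inverse_le[of "inverse a" C] by (auto simp: C_def)
  have "ennreal (inverse C * r powr s) \<le> emeasure \<mu> (cball x r) \<and>
      emeasure \<mu> (cball x r) \<le> ennreal (C * r powr s)"
    if "x \<in> A" "0 < r \<and> (bounded A \<longrightarrow> r < diameter A)" for x r
  proof
    have "ennreal (inverse C * r powr s) \<le> ennreal (a * r powr s)"
      by (intro ennreal_leI mult_right_mono C) simp
    also have "\<dots> \<le> emeasure \<mu> (cball x r)" using assms(4) that by blast
    finally show "ennreal (inverse C * r powr s) \<le> emeasure \<mu> (cball x r)" .
    have "emeasure \<mu> (cball x r) \<le> ennreal (K * r powr s)" using assms(5) that by blast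
    also have "\<dots> \<le> ennreal (C * r powr s)"
      by (intro ennreal_leI mult_right_mono C) simp
    finally show "emeasure \<mu> (cball x r) \<le> ennreal (C * r powr s)" .
  qed
  then show ?thesis unfolding ahlfors_regular_def using assms(1,2) C(1) by blast
qed

section \<open>The mass distribution principle\<close>

lemma ahlfors_regular_imp_hausdorff_measure_pos:
  fixes F :: "'a::metric_space set"
  assumes F: "compact F" "0 < diameter F" and s: "0 < s" and reg: "ahlfors_regular s F"
  shows "0 < hausdorff_measure s F"
proof -
  obtain \<mu> C where \<mu>: "radon_measure \<mu>" "AE x in \<mu>. x \<in> F" and C: "1 \<le> C"
    and bounds: "\<And>x r. x \<in> F \<Longrightarrow> 0 < r \<Longrightarrow> r < diameter F \<Longrightarrow>
      ennreal (inverse C * r powr s) \<le> emeasure \<mu> (cball x r) \<and>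
      emeasure \<mu> (cball x r) \<le> ennreal (C * r powr s)"
    using reg compact_imp_bounded[OF F(1)] unfolding ahlfors_regular_def by blast
  have sets: "sets \<mu> = sets borel" using \<mu>(1) by (simp add: radon_measure_def)
  have meas: "closed X \<Longrightarrow> X \<in> sets \<mu>" for X unfolding sets by (rule borel_closed)
  define d where "d = diameter F"
  \<comment> \<open>Covering sets may have diameter 0, so the bound is extended to radius 0 by
    letting radii shrink: as \<open>s > 0\<close>, points have no mass.\<close>
  have upper: "emeasure \<mu> (cball x r) \<le> ennreal (C * r powr s)" if x: "x \<in> F" and r: "0 \<le> r" "r < d" for x r
  proof (cases "r = 0")
    case False
    then show ?thesis using bounds x r by (simp add: d_def)
  next
    case True
    have "((\<lambda>t. C * t powr s) \<longlongrightarrow> C * 0 powr s) (at_right 0)"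
      using s by (intro tendsto_intros tendsto_powr2) (auto intro!: eventually_at_rightI[of 0 1])
    then have "((\<lambda>t. ennreal (C * t powr s)) \<longlongrightarrow> ennreal (C * 0 powr s)) (at_right 0)"
      by (rule tendsto_ennrealI)
    moreover have "\<forall>\<^sub>F t in at_right 0. emeasure \<mu> (cball x 0) \<le> ennreal (C * t powr s)"
    proof (rule eventually_at_rightI[of 0 d])
      fix t assume t: "t \<in> {0<..<d}"
      have "emeasure \<mu> (cball x 0) \<le> emeasure \<mu> (cball x t)"
        using t by (intro emeasure_mono meas) auto
      also have "\<dots> \<le> ennreal (C * t powr s)" using bounds x t by (simp add: d_def)
      finally show "emeasure \<mu> (cball x 0) \<le> ennreal (C * t powr s)" .
    qed (use F d_def in simp)
    ultimately show ?thesis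
      using True tendsto_lowerbound trivial_limit_at_right_real by blast
  qed
  obtain x0 where x0: "x0 \<in> F" using F(2) by force
  \<comment> \<open>Half the diameter is a radius strictly inside the range of the regularity
    bounds; the same choice serves as the scale of the covers below.\<close>
  define b where "b = inverse C * (d / 2) powr s"
  have b: "0 < b" using C F by (simp add: b_def d_def)
  have "ennreal b \<le> emeasure \<mu> (cball x0 (d / 2))"
    using bounds[OF x0, of "d / 2"] F by (simp add: b_def d_def)
  also have "\<dots> \<le> emeasure \<mu> F"
    using \<mu>(2) by (intro emeasure_mono_AE meas compact_imp_closed F) auto
  finally have bF: "ennreal b \<le> emeasure \<mu> F" .
  have "ennreal (b / C) \<le> (\<Sum>i. hausdorff_weight s (U i))"
    if U: "F \<subseteq> (\<Union>i. U i)" "\<forall>i. bounded (U i) \<and> diameter (U i) \<le> d / 2" for U :: "nat \<Rightarrow> 'a set"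
  proof -
    \<comment> \<open>Regularity controls only balls centred in \<open>F\<close>, so each covering
      set that meets \<open>F\<close> is replaced by a ball around one of its points in
      \<open>F\<close>.\<close>
    define B where "B i = (if U i \<inter> F = {} then {} else cball (SOME x. x \<in> U i \<inter> F) (diameter (U i)))" for i
    have B: "closed (B i)" "U i \<inter> F \<subseteq> B i" "emeasure \<mu> (B i) \<le> ennreal C * hausdorff_weight s (U i)" for i
    proof -
      have "closed (B i) \<and> U i \<inter> F \<subseteq> B i \<and> emeasure \<mu> (B i) \<le> ennreal C * hausdorff_weight s (U i)"
      proof (cases "U i \<inter> F = {}")
        case True
        then show ?thesis by (simp add: B_def)
      next
        case False
        define x where "x = (SOME x. x \<in> U i \<inter> F)"
        have x: "x \<in> U i" "x \<in> F" using someI_ex[of "\<lambda>x. x \<in> U i \<inter> F"] False unfolding x_def by auto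
        have Bi: "B i = cball x (diameter (U i))" using False by (simp add: B_def x_def)
        have "U i \<subseteq> B i" unfolding Bi using x U(2) by (intro subsetI) (simp add: diameter_bounded_bound)
        moreover have "emeasure \<mu> (B i) \<le> ennreal C * hausdorff_weight s (U i)"
        proof -
          have "diameter (U i) \<le> d / 2" "0 \<le> diameter (U i)" using U(2) by (auto simp: diameter_ge_0)
          then have "emeasure \<mu> (B i) \<le> ennreal (C * diameter (U i) powr s)"
            unfolding Bi using x F by (intro upper) (auto simp: d_def)
          then show ?thesis using s C by (simp add: hausdorff_weight_pos ennreal_mult)
        qed
        ultimately show ?thesis by (auto simp: Bi)
      qed
      then show "closed (B i)" "U i \<inter> F \<subseteq> B i" "emeasure \<mu> (B i) \<le> ennreal C * hausdorff_weight s (U i)" by auto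
    qed
    have "F \<subseteq> (\<Union>i. B i)"
    proof
      fix x assume "x \<in> F"
      moreover from this obtain i where "x \<in> U i" using U(1) by auto
      ultimately have "x \<in> B i" using B(2)[of i] by auto
      then show "x \<in> (\<Union>i. B i)" by auto
    qed
    then have "emeasure \<mu> F \<le> emeasure \<mu> (\<Union>i. B i)"
      by (intro emeasure_mono sets.countable_UN) (auto intro: meas B(1))
    also have "\<dots> \<le> (\<Sum>i. emeasure \<mu> (B i))"
      by (rule emeasure_subadditive_countably) (auto intro: meas B(1))
    also have "\<dots> \<le> (\<Sum>i. ennreal C * hausdorff_weight s (U i))"
      by (intro suminf_le B) simp_all
    also have "\<dots> = ennreal C * (\<Sum>i. hausdorff_weight s (U i))" by simp
    finally have "ennreal b \<le> ennreal C * (\<Sum>i. hausdorff_weight s (U i))" using bF by simp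
    then have "ennreal (1 / C) * ennreal b \<le> ennreal (1 / C) * (ennreal C * (\<Sum>i. hausdorff_weight s (U i)))"
      by (rule mult_left_mono) simp
    also have "\<dots> = (\<Sum>i. hausdorff_weight s (U i))"
      using C by (simp add: mult.assoc[symmetric] ennreal_mult[symmetric])
    finally show ?thesis using C b by (simp add: ennreal_mult[symmetric])
  qed
  then have "ennreal (b / C) \<le> hausdorff_premeasure s (d / 2) F"
    unfolding hausdorff_premeasure_def by (intro INF_greatest) auto
  also have "\<dots> \<le> hausdorff_measure s F"
    using F by (intro hausdorff_premeasure_le_measure) (simp add: d_def)
  finally have "ennreal (b / C) \<le> hausdorff_measure s F" .
  moreover have "0 < ennreal (b / C)" using b C by simp
  ultimately show ?thesis by (rule less_le_trans[rotated])
qed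

section \<open>Positive dimension, packing and finite Hausdorff measure\<close>

lemma diameter_pos_two_points:
  fixes F :: "'a::metric_space set"
  assumes "0 < diameter F"
  obtains a b where "a \<in> F" "b \<in> F" "a \<noteq> b"
proof -
  have "\<exists>a\<in>F. \<exists>b\<in>F. a \<noteq> b"
  proof (rule ccontr)
    assume "\<not> ?thesis"
    then have "diameter F \<le> 0" by (intro diameter_le_dist) auto
    then show False using assms by simp
  qed
  then show thesis using that by blast
qed

text \<open>With exponent 0, the cardinality bound for two distinct points at a third of their
  distance would read \<open>2 \<le> 1\<close>.\<close>

lemma embeds_in_balls_dim_pos:
  fixes F :: "'a::metric_space set"
  assumes F: "compact F" "0 < diameter F" and D: "1 \<le> D" "embeds_in_balls D F"
    and dim: "ereal s = hausdorff_dim F"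
  shows "0 < s"
proof (rule ccontr)
  assume "\<not> 0 < s"
  moreover have "0 \<le> ereal s" unfolding dim by (rule hausdorff_dim_nonneg)
  ultimately have s: "s = 0" by simp
  obtain a b where ab: "a \<in> F" "b \<in> F" "a \<noteq> b" using diameter_pos_two_points[OF F(2)] .
  have "dist a b \<le> diameter F"
    using ab F by (intro diameter_bounded_bound compact_imp_bounded)
  moreover have "0 < dist a b" using ab by simp
  ultimately have r: "0 < dist a b / 3" "dist a b / 3 \<le> diameter F" by linarith+
  have "real (card {a, b}) * (dist a b / 3 / D) powr s \<le> 1"
    using ab F by (intro separated_card_bound[OF _ F(1) D dim _ _ _ r])
      (auto simp: pairwise_def dist_commute)
  then show False using ab s r(1) D(1) by auto
qed

text \<open>Adding \<open>diameter F\<close> to \<open>D\<close> makes the right-hand side at least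
  1 for all \<open>r \<le> diameter F\<close>, which absorbs sets with fewer than two
  points.\<close>

lemma embeds_in_balls_packing:
  fixes F :: "'a::metric_space set"
  assumes F: "compact F" and D: "1 \<le> D" "embeds_in_balls D F"
    and dim: "ereal s = hausdorff_dim F" and s: "0 < s"
    and S: "finite S" "S \<subseteq> F" and r: "0 < r" "r \<le> diameter F"
    and sep: "pairwise (\<lambda>x y. 3 * r \<le> dist x y) S"
  shows "real (card S) \<le> ((D + diameter F) / r) powr s"
proof (cases "2 \<le> card S")
  case True
  then have "F \<noteq> {}" using S by auto
  then have "real (card S) * (r / D) powr s \<le> 1"
    using separated_card_bound[OF _ F D dim S True r sep] by blast
  then have "real (card S) \<le> 1 / (r / D) powr s"
    using r D by (simp add: field_simps)
  also have "\<dots> = (D / r) powr s" using r D by (simp add: powr_divide)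
  also have "\<dots> \<le> ((D + diameter F) / r) powr s"
    using r D s by (intro powr_mono2 divide_right_mono) auto
  finally show ?thesis .
next
  case False
  then have "real (card S) \<le> 1" by simp
  also have "1 \<le> (D + diameter F) / r" using r D by (simp add: field_simps)
  then have "1 \<le> ((D + diameter F) / r) powr s" using s by (intro ge_one_powr_ge_zero) auto
  finally show ?thesis .
qed

text \<open>A maximal \<open>3 * r\<close>-separated set gives a cover by balls of diameter at most
  \<open>6 * r\<close>; in the product with the packing bound the radius cancels, so the estimate is
  uniform in the scale.\<close>

lemma embeds_in_balls_hausdorff_measure_le:
  fixes F :: "'a::metric_space set"
  assumes F: "compact F" "0 < diameter F" and D: "1 \<le> D" "embeds_in_balls D F"
    and dim: "ereal s = hausdorff_dim F" and s: "0 < s"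
  shows "hausdorff_measure s F \<le> ennreal ((6 * (D + diameter F)) powr s)"
  unfolding hausdorff_measure_def
proof (rule SUP_least)
  fix \<delta> :: real assume "\<delta> \<in> {0<..}"
  define r where "r = min (diameter F) (\<delta> / 6)"
  have r: "0 < r" "r \<le> diameter F" "6 * r \<le> \<delta>" using F \<open>\<delta> \<in> _\<close> by (auto simp: r_def)
  note card = embeds_in_balls_packing[OF F(1) D dim s _ _ r(1,2)]
  have "card S \<le> nat \<lfloor>((D + diameter F) / r) powr s\<rfloor>"
    if "finite S" "S \<subseteq> F" "pairwise (\<lambda>x y. 3 * r \<le> dist x y) S" for S
    using card[OF that] by (simp add: le_nat_floor)
  then obtain S where S: "finite S" "S \<subseteq> F" "pairwise (\<lambda>x y. 3 * r \<le> dist x y) S"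
    "F \<subseteq> (\<Union>x\<in>S. cball x (3 * r))"
    using maximal_separated_subset[of "3 * r" F "nat \<lfloor>((D + diameter F) / r) powr s\<rfloor>"] r(1) by auto
  have "hausdorff_premeasure s \<delta> F \<le> ennreal (\<Sum>x\<in>S. (2 * (3 * r)) powr s)"
    using r by (intro hausdorff_premeasure_cballs[OF s S(1,4)]) auto
  also have "\<dots> \<le> ennreal ((6 * (D + diameter F)) powr s)"
  proof (rule ennreal_leI)
    have "(\<Sum>x\<in>S. (2 * (3 * r)) powr s) = card S * (6 * r) powr s" by simp
    also have "\<dots> \<le> ((D + diameter F) / r) powr s * (6 * r) powr s"
      by (intro mult_right_mono card S) simp
    also have "\<dots> = ((D + diameter F) / r * (6 * r)) powr s"
      using r D by (subst powr_mult) auto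
    also have "(D + diameter F) / r * (6 * r) = 6 * (D + diameter F)" using r by simp
    finally show "(\<Sum>x\<in>S. (2 * (3 * r)) powr s) \<le> (6 * (D + diameter F)) powr s" .
  qed
  finally show "hausdorff_premeasure s \<delta> F \<le> ennreal ((6 * (D + diameter F)) powr s)" .
qed

text \<open>A ball violating the bound yields disjoint balls of density at least
  \<open>L > h / c0\<close> whose radii to the power \<open>s\<close> sum to at least
  \<open>c0\<close>; together they would weigh more than the total mass \<open>h\<close>.\<close>

lemma embeds_in_balls_upper_regular:
  fixes F :: "'a::metric_space set"
  assumes F: "compact F" "0 < diameter F" and D: "1 \<le> D" "embeds_in_balls D F"
    and dim: "ereal s = hausdorff_dim F" and s: "0 < s"
    and \<mu>: "sets \<mu> = sets borel"
      "\<And>A. A \<in> sets borel \<Longrightarrow> emeasure \<mu> A = hausdorff_measure s (A \<inter> F)"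
    and pos: "0 < hausdorff_measure s F"
  obtains K where "\<And>x r. x \<in> F \<Longrightarrow> 0 < r \<Longrightarrow> emeasure \<mu> (cball x r) \<le> ennreal (K * r powr s)"
proof -
  have space: "space \<mu> = UNIV" using sets_eq_imp_space_eq[OF \<mu>(1)] by simp
  have H_fin: "hausdorff_measure s F < \<infinity>"
    using embeds_in_balls_hausdorff_measure_le[OF F D dim s] by (rule le_less_trans) simp
  interpret finite_measure \<mu>
    using H_fin \<mu>(2)[of UNIV] by (intro finite_measureI) (simp add: space)
  define h where "h = measure \<mu> UNIV"
  have h: "0 \<le> h" by (simp add: h_def)
  have em: "emeasure \<mu> (cball x r) = ennreal (measure \<mu> (cball x r))" for x r
    by (rule emeasure_eq_measure)
  \<comment> \<open>One scale with positive premeasure is fixed before the offending ball is chosen,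
    so \<open>m\<close> and \<open>c0\<close> do not depend on that ball.\<close>
  obtain \<delta> where \<delta>: "0 < \<delta>" "0 < hausdorff_premeasure s \<delta> F"
    using pos unfolding hausdorff_measure_def less_SUP_iff by auto
  define m where "m = enn2real (hausdorff_premeasure s \<delta> F)"
  have "hausdorff_premeasure s \<delta> F < \<infinity>"
    using hausdorff_premeasure_le_measure[OF \<delta>(1)] H_fin by (rule le_less_trans)
  then have m: "0 < m" "hausdorff_premeasure s \<delta> F = ennreal m"
    using \<delta>(2) by (auto simp: m_def enn2real_positive_iff)
  define c0 where "c0 = m / (2 * 4 powr s)"
  have c0: "0 < c0" using m by (simp add: c0_def)
  define K where "K = h / c0 * D powr (2 * s)"
  show thesis
  proof (rule that[of K], rule ccontr)
    fix x r assume x: "x \<in> F" and r: "0 < r" and "\<not> emeasure \<mu> (cball x r) \<le> ennreal (K * r powr s)"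
    then have big: "K * r powr s < measure \<mu> (cball x r)"
      unfolding em by (meson ennreal_leI not_le)
    \<comment> \<open>Dividing by \<open>D powr (2 * s)\<close> discounts in advance what an
      embedding may lose, so every copy still has density at least \<open>L\<close>.\<close>
    define L where "L = measure \<mu> (cball x r) / (D powr (2 * s) * r powr s)"
    have L: "h / c0 < L" using big r D by (simp add: L_def K_def field_simps)
    then have L0: "0 \<le> L" using h c0 by (meson divide_nonneg_pos le_less_trans less_imp_le)
    define \<Delta> where "\<Delta> = {(z, t). 0 < t \<and> L * t powr s \<le> measure \<mu> (cball z t)}"
    have dense: "\<exists>z. dist y z \<le> \<rho> \<and> (z, D * r * \<rho>) \<in> \<Delta>"
      if y: "y \<in> F" and \<rho>: "0 < \<rho>" "\<rho> \<le> diameter F" for y \<rho>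
    proof -
      obtain g where g: "g ` F \<subseteq> F" "g ` F \<subseteq> cball y \<rho>"
        "\<And>u v. u \<in> F \<Longrightarrow> v \<in> F \<Longrightarrow> \<rho> / D * dist u v \<le> dist (g u) (g v)"
        "\<And>u v. u \<in> F \<Longrightarrow> v \<in> F \<Longrightarrow> dist (g u) (g v) \<le> D * \<rho> * dist u v"
        using embeds_in_ballsE[OF D(2) y \<rho>] by blast
      have "g ` (cball x r \<inter> F) \<subseteq> cball (g x) (D * r * \<rho>) \<inter> F"
      proof
        fix w assume "w \<in> g ` (cball x r \<inter> F)"
        then obtain u where u: "w = g u" "u \<in> F" "dist x u \<le> r" by auto
        have "dist (g x) (g u) \<le> D * \<rho> * dist x u" using g(4) x u by blast
        also have "\<dots> \<le> D * \<rho> * r" using u D \<rho> by (intro mult_left_mono) auto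
        finally show "w \<in> cball (g x) (D * r * \<rho>) \<inter> F" using u g(1) by (auto simp: mult_ac)
      qed
      then have "hausdorff_measure s (g ` (cball x r \<inter> F)) \<le> emeasure \<mu> (cball (g x) (D * r * \<rho>))"
        by (simp add: \<mu>(2) hausdorff_measure_mono)
      moreover have "ennreal ((\<rho> / D) powr s) * emeasure \<mu> (cball x r) \<le> hausdorff_measure s (g ` (cball x r \<inter> F))"
        using \<rho> D g(3) by (simp add: \<mu>(2)) (intro hausdorff_measure_lower_lipschitz[OF s], auto)
      ultimately have "ennreal ((\<rho> / D) powr s) * ennreal (measure \<mu> (cball x r)) \<le>
          ennreal (measure \<mu> (cball (g x) (D * r * \<rho>)))"
        unfolding em by (rule order_trans[rotated])
      then have "(\<rho> / D) powr s * measure \<mu> (cball x r) \<le> measure \<mu> (cball (g x) (D * r * \<rho>))"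
        by (simp add: ennreal_mult[symmetric])
      moreover have "L * (D * r * \<rho>) powr s = (\<rho> / D) powr s * measure \<mu> (cball x r)"
      proof -
        have "D powr (2 * s) = D powr s * D powr s" by (simp add: powr_add[symmetric])
        then show ?thesis
          using D r \<rho> by (simp add: L_def powr_mult powr_divide field_simps)
      qed
      ultimately have "(g x, D * r * \<rho>) \<in> \<Delta>" using D r \<rho> by (simp add: \<Delta>_def)
      moreover have "dist y (g x) \<le> \<rho>" using g(2) x by auto
      ultimately show ?thesis by blast
    qed
    have cover: "m \<le> (\<Sum>i\<in>I. (2 * R i) powr s)"
      if "finite I" "F \<subseteq> (\<Union>i\<in>I. cball (fst i) (R i))" "\<And>i. i \<in> I \<Longrightarrow> 0 \<le> R i \<and> 2 * R i \<le> \<delta>"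
      for I :: "('a \<times> real) set" and R
    proof -
      have "ennreal m \<le> ennreal (\<Sum>i\<in>I. (2 * R i) powr s)"
        unfolding m(2)[symmetric]
        using that \<delta>(1) by (intro hausdorff_premeasure_cballs[OF s that(1,2)]) auto
      then show ?thesis by (simp add: ennreal_le_iff sum_nonneg)
    qed
    have pack: "\<exists>N. \<forall>S. finite S \<and> S \<subseteq> F \<and> pairwise (\<lambda>x y. e \<le> dist x y) S \<longrightarrow> card S \<le> N"
      if e: "0 < e" for e
    proof (intro exI allI impI)
      fix S assume S: "finite S \<and> S \<subseteq> F \<and> pairwise (\<lambda>x y. e \<le> dist x y) S"
      \<comment> \<open>The packing bound is limited to radii up to the diameter; for larger
        \<open>e\<close> it is applied at the diameter itself.\<close>
      let ?r = "min (diameter F) (e / 3)"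
      have "pairwise (\<lambda>x y. 3 * ?r \<le> dist x y) S"
      proof (rule pairwiseI)
        fix x y assume "x \<in> S" "y \<in> S" "x \<noteq> y"
        then have "e \<le> dist x y" using S pairwiseD by metis
        then show "3 * ?r \<le> dist x y" by (simp add: min_def)
      qed
      then have "real (card S) \<le> ((D + diameter F) / ?r) powr s"
        using S e F(2) by (intro embeds_in_balls_packing[OF F(1) D dim s]) auto
      then show "card S \<le> nat \<lfloor>((D + diameter F) / ?r) powr s\<rfloor>" by (simp add: le_nat_floor)
    qed
    have \<Delta>_pos: "\<And>z t. (z, t) \<in> \<Delta> \<Longrightarrow> 0 < t" by (simp add: \<Delta>_def)
    have \<theta>: "0 < D * r" using D r by simp
    have "\<exists>T. finite T \<and> T \<subseteq> \<Delta> \<and> disjoint_family_on (\<lambda>(z, t). cball z t) T \<and>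
      c0 \<le> (\<Sum>(z, t)\<in>T. t powr s)"
      unfolding c0_def
      by (rule dense_balls_family[OF s \<theta> F(2) \<delta>(1) m(1), where F = F])
        (fact cover pack \<Delta>_pos dense)+
    then obtain T where T: "finite T" "T \<subseteq> \<Delta>" "disjoint_family_on (\<lambda>(z, t). cball z t) T"
      "c0 \<le> (\<Sum>(z, t)\<in>T. t powr s)"
      by blast
    have "L * c0 \<le> L * (\<Sum>(z, t)\<in>T. t powr s)" by (rule mult_left_mono[OF T(4) L0])
    also have "\<dots> \<le> (\<Sum>(z, t)\<in>T. measure \<mu> (cball z t))"
      unfolding sum_distrib_left using T(2) by (intro sum_mono) (auto simp: \<Delta>_def)
    also have "\<dots> = (\<Sum>i\<in>T. measure \<mu> (case i of (z, t) \<Rightarrow> cball z t))"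
      by (simp add: case_prod_unfold)
    also have "\<dots> = measure \<mu> (\<Union>i\<in>T. case i of (z, t) \<Rightarrow> cball z t)"
      using T by (intro finite_measure_finite_Union[symmetric]) (auto simp: \<mu>(1))
    also have "\<dots> \<le> h" unfolding h_def space[symmetric] by (rule bounded_measure)
    finally show False using L c0 by (simp add: field_simps)
  qed
qed

text \<open>The sort describes Polish spaces, where finite Borel measures are Radon.\<close>

lemma embeds_in_balls_imp_ahlfors_regular:
  fixes F :: "'a::{second_countable_topology, complete_space} set"
  assumes F: "compact F" "0 < diameter F" and D: "1 \<le> D" "embeds_in_balls D F"
    and dim: "ereal s = hausdorff_dim F" and pos: "0 < hausdorff_measure s F"
  shows "ahlfors_regular s F"
proof -
  have s: "0 < s" by (rule embeds_in_balls_dim_pos[OF F D dim])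
  have H_fin: "hausdorff_measure s F < \<infinity>"
    using embeds_in_balls_hausdorff_measure_le[OF F D dim s] by (rule le_less_trans) simp
  define h where "h = enn2real (hausdorff_measure s F)"
  have h: "0 < h" "hausdorff_measure s F = ennreal h"
    using pos H_fin by (auto simp: h_def enn2real_positive_iff)
  obtain \<mu> where \<mu>: "sets \<mu> = sets borel"
      "\<And>A. A \<in> sets borel \<Longrightarrow> emeasure \<mu> A = hausdorff_measure s (A \<inter> F)"
    using hausdorff_measure_restricted[of s F] by blast
  have space: "space \<mu> = UNIV" using sets_eq_imp_space_eq[OF \<mu>(1)] by simp
  have F_closed: "closed F" using F(1) by (rule compact_imp_closed)
  obtain K where K: "\<And>x r. x \<in> F \<Longrightarrow> 0 < r \<Longrightarrow> emeasure \<mu> (cball x r) \<le> ennreal (K * r powr s)"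
    using embeds_in_balls_upper_regular[OF F D dim s \<mu> pos] by blast
  show ?thesis
  proof (rule ahlfors_regularI)
    show "radon_measure \<mu>"
      using \<mu> H_fin by (intro radon_measure_finite) (simp_all add: space)
    have "- F \<in> null_sets \<mu>" using F_closed \<mu> by (simp add: null_sets_def)
    then show "AE x in \<mu>. x \<in> F" by (rule AE_I') auto
    show "0 < inverse D powr s * h" using D h by simp
    show "emeasure \<mu> (cball x r) \<le> ennreal (K * r powr s)" if "x \<in> F" "0 < r" for x r
      using K that by blast
    fix x r assume x: "x \<in> F" and r: "0 < r" and "bounded F \<Longrightarrow> r < diameter F"
    then have rd: "r \<le> diameter F" using compact_imp_bounded[OF F(1)] by simp
    obtain g where g: "g ` F \<subseteq> F" "g ` F \<subseteq> cball x r"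
      "\<And>u v. u \<in> F \<Longrightarrow> v \<in> F \<Longrightarrow> r / D * dist u v \<le> dist (g u) (g v)"
      by (rule embeds_in_ballsE[OF D(2) x r rd]) (rule that)
    have "inverse D powr s * h * r powr s = (r / D) powr s * h"
      using D r by (simp add: powr_divide powr_mult inverse_powr field_simps)
    then have "ennreal (inverse D powr s * h * r powr s) = ennreal ((r / D) powr s) * hausdorff_measure s F"
      using h by (simp only: ennreal_mult powr_ge_zero less_imp_le)
    also have "\<dots> \<le> hausdorff_measure s (g ` F)"
      using r D by (intro hausdorff_measure_lower_lipschitz[OF s _ g(3)]) auto
    also have "\<dots> \<le> emeasure \<mu> (cball x r)"
      unfolding \<mu>(2)[OF borel_closed[OF closed_cball]] using g by (intro hausdorff_measure_mono) auto
    finally show "ennreal (inverse D powr s * h * r powr s) \<le> emeasure \<mu> (cball x r)" .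
  qed
qed

section \<open>One-point sets\<close>

lemma hausdorff_measure_singleton:
  assumes "0 < t" shows "hausdorff_measure t {x} = 0"
proof -
  have "hausdorff_premeasure t \<delta> {x} \<le> 0" if "0 < \<delta>" for \<delta>
    using hausdorff_premeasure_le[of "{x}" "\<lambda>_. {x}" \<delta> t] assms that
    by (simp add: hausdorff_weight_pos)
  then have "hausdorff_measure t {x} \<le> 0"
    unfolding hausdorff_measure_def by (intro SUP_least) auto
  then show ?thesis by simp
qed

lemma hausdorff_dim_singleton: "hausdorff_dim {x} = 0"
proof (rule antisym)
  have "hausdorff_dim {x} \<le> ereal e" if "0 < e" for e
    unfolding hausdorff_dim_def using that by (intro Inf_lower) (auto simp: hausdorff_measure_singleton)
  then show "hausdorff_dim {x} \<le> 0"
    by (intro ereal_le_epsilon2[of "hausdorff_dim {x}" 0]) simp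
qed (rule hausdorff_dim_nonneg)

text \<open>The diameter is 0, so there are no admissible radii, and even the null measure is a
  witness.\<close>

lemma ahlfors_regular_singleton:
  fixes x :: "'a::{second_countable_topology, complete_space}"
  shows "ahlfors_regular s {x}"
proof (rule ahlfors_regularI[where a = 1])
  show "radon_measure (null_measure (borel :: 'a measure))"
    by (rule radon_measure_finite) simp_all
  show "AE y in null_measure borel. y \<in> {x}" by (rule AE_I'[of UNIV]) (auto simp: null_sets_def)
qed auto

theorem proposition2p2:
  fixes F :: "(real ^ 'd) set" and s :: real
  assumes "F \<noteq> {}" and "compact F"
    and "\<exists>D::real. 1 \<le> D \<and>
           (\<forall>x\<in>F. \<forall>r. 0 < r \<and> r \<le> diameter F \<longrightarrow>
              (\<exists>g. g ` F \<subseteq> F \<inter> cball x r \<and>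
                 (\<forall>y\<in>F. \<forall>z\<in>F. inverse D * r * dist y z \<le> dist (g y) (g z) \<and>
                              dist (g y) (g z) \<le> D * r * dist y z)))"
    and "ereal s = hausdorff_dim F"
  shows "0 < hausdorff_measure s F \<longleftrightarrow> ahlfors_regular s F"
proof (cases "0 < diameter F")
  case True
  obtain D where D: "1 \<le> D" "embeds_in_balls D F"
    using assms(3) unfolding embeds_in_balls_def by blast
  have "0 < s" by (rule embeds_in_balls_dim_pos[OF assms(2) True D assms(4)])
  then show ?thesis
    using embeds_in_balls_imp_ahlfors_regular[OF assms(2) True D assms(4)]
      ahlfors_regular_imp_hausdorff_measure_pos[OF assms(2) True] by blast
next
  case False
  \<comment> \<open>Here \<open>F\<close> is a single point and \<open>s = 0\<close>; both sides of
    the equivalence hold.\<close>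
  obtain x where x: "x \<in> F" using assms(1) by blast
  have "y = x" if "y \<in> F" for y
  proof -
    have "dist y x \<le> diameter F"
      by (rule diameter_bounded_bound[OF compact_imp_bounded[OF assms(2)] that x])
    then have "dist y x \<le> 0" using False by linarith
    then show ?thesis by simp
  qed
  then have F: "F = {x}" using x by blast
  then have "s = 0" using assms(4) by (simp add: hausdorff_dim_singleton)
  then have "1 \<le> hausdorff_measure s F" using hausdorff_measure_0_pos[OF assms(1)] by simp
  then have "0 < hausdorff_measure s F" by (rule less_le_trans[rotated]) simp
  then show ?thesis using ahlfors_regular_singleton F by simp
qed

end
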